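(* Assume bifurcation assumption (B) with the maximal cells critical (i.e. $\sum_{\sigma\in\Sigma}a_\sigma=0$, all non-maximal cells non-critical), and genericity. Let $m$ be the number of maximal cells. Then: (i) (supercritical) if $\ell/\sum_{\sigma,\tau\in\Sigma}f_{\sigma\tau}<0$, there are $2^m$ branches of steady states, each of the form $x_p(\lambda)=D_p\sqrt{\lambda}+O(|\lambda|)$ for all $p\in C$ and small $\lambda>0$; (ii) (subcritical) if $\ell/\sum_{\sigma,\tau\in\Sigma}f_{\sigma\tau}>0$, there are $2^m$ branches of steady states, each of the form $x_p(\lambda)=D_p\sqrt{-\lambda}+O(|\lambda|)$ for all $p\in C$ and small $\lambda<0$. The coefficients are defined recursively along $\trianglelefteq$: for maximal $p$, $D_p\in\{\pm\sqrt{-\ell/\sum_{\sigma,\tau\in\Sigma}f_{\sigma\tau}}\}$ in case (i) and $D_p\in\{\pm\sqrt{\ell/\sum_{\sigma,\tau\in\Sigma}f_{\sigma\tau}}\}$ in case (ii), with the sign chosen independently for each maximal cell (these $2^m$ choices determine the branches); for non-maximal $p$, $$D_p=-\frac{\sum_{\tau\notin\mathcal L_p}a_\tau D_{\tau(p)}}{\sum_{\sigma\in\mathcal L_p}a_\sigma}=\frac{\sum_{\tau\notin\mathcal L_p}a_\tau D_{\tau(p)}}{\sum_{\tau\notin\mathcal L_p}a_\tau}.$$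
   Context: Network: finite set of cells $C$, set $\Sigma=\{\sigma_1,\dots,\sigma_n\}$ of pairwise distinct maps $C\to C$ with $\sigma_1=\mathrm{Id}_C$; arrow of type $\sigma$ from $q$ to $p$ iff $\sigma(p)=q$; paths are sets of pairwise distinct cells $\{p_1,\dots,p_k\}$ with $\tau_j(p_{j+1})=p_j$ for some $\tau_j\in\Sigma$; the network is feedforward (no cycles of length $\ge2$, where a cycle is a path $\{p_1,\dots,p_k\}$ with additionally $\tau(p_1)=p_k$ for some $\tau$). $p\trianglelefteq q$ iff there is a path from $q$ to $p$ (a partial order); maximal cells are the maximal elements, equivalently the cells with $\sigma(p)=p$ for all $\sigma$. Bifurcation setting: $V=\mathbb R$, $f\colon\mathbb R^n\times\mathbb R\to\mathbb R$ smooth with its first $n$ arguments labelled by $\Sigma$, $\gamma_f(x,\lambda)_p=f(x_{\sigma_1(p)},\dots,x_{\sigma_n(p)},\lambda)$; steady states are solutions of $\gamma_f(x,\lambda)=0$ near $(0,0)\in\mathbb R^C\times\mathbb R$. Coefficients: $a_\sigma=\partial_\sigma f(0,0)$, $f_{\sigma\tau}=\tfrac12\partial_\sigma\partial_\tau f(0,0)$, $\ell=\partial_\lambda f(0,0)$. $\mathcal L_p=\{\sigma:\sigma(p)=p\}$; $p$ is critical if $\sum_{\sigma\in\mathcal L_p}a_\sigma=0$. Bifurcation assumption (B): $f(0,0)=0$, some cell is critical, and exactly the cells with the same $\mathcal L_p$ as a critical cell are critical. "Generic" means for an open dense set of the relevant Taylor coefficients of $f$ at $(0,0)$; in particular the statement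 presupposes that the recursively defined $D_p$ are nonzero. *)

theory Defs
  imports "HOL-Analysis.Analysis"
begin

coinductive smooth_fun :: "('a::real_normed_vector \<Rightarrow> real) \<Rightarrow> bool" where
  "(\<And>x. (f has_derivative D x) (at x)) \<Longrightarrow> (\<And>v. smooth_fun (\<lambda>x. D x v)) \<Longrightarrow> smooth_fun f"

text \<open>Networks: cells are the elements of a finite type 'c, the maps of Sigma are
  indexed by a finite type 's via sig :: 's => 'c => 'c.\<close>

definition network :: "('s::finite \<Rightarrow> 'c::finite \<Rightarrow> 'c) \<Rightarrow> bool" where
  "network sig \<longleftrightarrow> inj sig \<and> (\<exists>s1. sig s1 = id)"

definition is_path :: "('s \<Rightarrow> 'c \<Rightarrow> 'c) \<Rightarrow> 'c list \<Rightarrow> bool" where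
  "is_path sig ps \<longleftrightarrow> distinct ps \<and>
     (\<forall>j. Suc j < length ps \<longrightarrow> (\<exists>t. sig t (ps ! Suc j) = ps ! j))"

definition is_cycle :: "('s \<Rightarrow> 'c \<Rightarrow> 'c) \<Rightarrow> 'c list \<Rightarrow> bool" where
  "is_cycle sig ps \<longleftrightarrow> is_path sig ps \<and> ps \<noteq> [] \<and> (\<exists>t. sig t (ps ! 0) = last ps)"

definition feedforward :: "('s \<Rightarrow> 'c \<Rightarrow> 'c) \<Rightarrow> bool" where
  "feedforward sig \<longleftrightarrow> (\<forall>ps. is_cycle sig ps \<longrightarrow> length ps < 2)"

definition maximal_cell :: "('s \<Rightarrow> 'c \<Rightarrow> 'c) \<Rightarrow> 'c \<Rightarrow> bool" where
  "maximal_cell sig p \<longleftrightarrow> (\<forall>s. sig s p = p)"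

definition Lset :: "('s \<Rightarrow> 'c \<Rightarrow> 'c) \<Rightarrow> 'c \<Rightarrow> 's set" where
  "Lset sig p = {s. sig s p = p}"

definition gamma :: "('s::finite \<Rightarrow> 'c::finite \<Rightarrow> 'c) \<Rightarrow> ((real^'s) \<times> real \<Rightarrow> real)
     \<Rightarrow> real^'c \<Rightarrow> real \<Rightarrow> real^'c" where
  "gamma sig f x lam = (\<chi> p. f (\<chi> s. x $ sig s p, lam))"

definition coef_a :: "((real^'s::finite) \<times> real \<Rightarrow> real) \<Rightarrow> 's \<Rightarrow> real" where
  "coef_a f s = frechet_derivative f (at 0) (axis s 1, 0)"

definition coef_l :: "((real^'s::finite) \<times> real \<Rightarrow> real) \<Rightarrow> real" where
  "coef_l f = frechet_derivative f (at 0) (0, 1)"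

definition coef_f2 :: "((real^'s::finite) \<times> real \<Rightarrow> real) \<Rightarrow> 's \<Rightarrow> 's \<Rightarrow> real" where
  "coef_f2 f s t = 1/2 * frechet_derivative
      (\<lambda>z. frechet_derivative f (at z) (axis t 1, 0)) (at 0) (axis s 1, 0)"

definition critical :: "('s::finite \<Rightarrow> 'c \<Rightarrow> 'c) \<Rightarrow> ((real^'s) \<times> real \<Rightarrow> real) \<Rightarrow> 'c \<Rightarrow> bool" where
  "critical sig f p \<longleftrightarrow> (\<Sum>s\<in>Lset sig p. coef_a f s) = 0"

definition Dcoeffs :: "('s::finite \<Rightarrow> 'c \<Rightarrow> 'c) \<Rightarrow> ((real^'s) \<times> real \<Rightarrow> real) \<Rightarrow> real
     \<Rightarrow> ('c \<Rightarrow> real) set" where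
  "Dcoeffs sig f c = {D.
     (\<forall>p. maximal_cell sig p \<longrightarrow> (D p = c \<or> D p = - c)) \<and>
     (\<forall>p. \<not> maximal_cell sig p \<longrightarrow>
        D p = - (\<Sum>t\<in>- Lset sig p. coef_a f t * D (sig t p)) / (\<Sum>s\<in>Lset sig p. coef_a f s))}"

end

theory Submission
  imports Defs
begin

text \<open>
  Put \<open>\<lambda> = sg * \<mu>\<^sup>2\<close> with \<open>sg = 1\<close> (supercritical) or \<open>sg = -1\<close> (subcritical) and \<open>\<mu> > 0\<close>, substitute
  \<open>x = \<mu> * w\<close>, and divide the equation of a maximal cell by \<open>\<mu>\<^sup>2\<close>, that of any other cell by \<open>\<mu>\<close>. As
  \<open>\<mu> \<rightarrow> 0\<close> the system becomes \<open>S * (w\<^sub>p\<^sup>2 - c\<^sup>2) = 0\<close> for maximal \<open>p\<close> and \<open>\<Sum>\<^sub>\<sigma> a\<^sub>\<sigma> * w\<^sub>\<sigma>\<^sub>(\<^sub>p\<^sub>) = 0\<close> otherwise;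
  its solutions are exactly the coefficient vectors \<open>D\<close>, and its linearisation at each of them is
  triangular along the network, hence invertible. A contraction argument continues every \<open>D\<close> to a
  unique nearby branch with \<open>w = D + O(\<mu>)\<close>. Conversely, a priori estimates show that every small
  steady state satisfies \<open>x = \<mu> * D + O(\<mu>\<^sup>2)\<close> for some \<open>D\<close>, so there are no other branches.
\<close>

section \<open>Second-order estimates for smooth functions\<close>

text \<open>Two powers of \<mu> can be divided out at a maximal cell because all its inputs equal
  its own state and the coefficients \<open>coef_a f s\<close> sum to 0, so its equation has no
  linear term in the state. The rescaled equations involve divisions by \<mu> and make sense only
  for \<open>\<mu> > 0\<close>; the continuation from the limit system therefore rests on a
  contraction with bounds uniform in small \<mu>, not on a system defined at
  \<open>\<mu> = 0\<close>. The contraction yields uniqueness of \<open>w\<close> only in a fixed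
  ball around each \<open>D\<close>, whereas a steady state with \<open>norm x < r\<close>
  corresponds to a \<open>w\<close> that may be as large as \<open>r / \<mu>\<close>. The a priori
  estimates close this gap: for small \<open>r\<close> the quadratic terms are absorbed by the
  left-hand side, which forces \<open>x\<close> to be of order \<mu>, and inserting this bound once
  more yields the error of order \<open>\<mu>\<^sup>2\<close>. The sum called \<open>S\<close> in
  the overview is \<open>Q\<close> below.\<close>

lemma smooth_fun_has_derivative:
  assumes "smooth_fun f"
  shows "(f has_derivative frechet_derivative f (at z)) (at z)"
  using assms
proof cases
  case (1 D)
  then show ?thesis
    by (metis frechet_derivative_at)
qed

lemma smooth_fun_frechet_derivative:
  assumes "smooth_fun f"
  shows "smooth_fun (\<lambda>z. frechet_derivative f (at z) v)"
  using assms
proof cases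
  case (1 D)
  then have "frechet_derivative f (at z) = D z" for z
    by (metis frechet_derivative_at)
  then show ?thesis
    using 1 by simp
qed

lemma has_derivative_imp_local_Lipschitz_at_zero:
  assumes "(f has_derivative f') (at (0::'a::real_normed_vector))"
  shows "\<exists>K>0. \<forall>\<^sub>F z in nhds 0. norm (f z - f 0) \<le> K * norm z"
proof -
  interpret bounded_linear f'
    using assms by (rule has_derivative_bounded_linear)
  obtain B where B: "B > 0" "\<And>x. norm (f' x) \<le> norm x * B"
    using pos_bounded by blast
  obtain d where d: "d > 0" "\<And>y. norm (y - 0) < d \<Longrightarrow> norm (f y - f 0 - f' (y - 0)) \<le> 1 * norm (y - 0)"
    using assms unfolding has_derivative_at_alt by (meson zero_less_one)
  have "norm (f z - f 0) \<le> (B + 1) * norm z" if "norm z < d" for z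
  proof -
    have "norm (f z - f 0) \<le> norm (f z - f 0 - f' z) + norm (f' z)"
      by (metis norm_triangle_sub add.commute)
    then show ?thesis
      using d(2)[of z] B(2)[of z] that by (simp add: algebra_simps)
  qed
  then have "\<forall>\<^sub>F z in nhds 0. norm (f z - f 0) \<le> (B + 1) * norm z"
    unfolding eventually_nhds_metric using d(1) by auto
  then show ?thesis
    using B(1) by (intro exI[of _ "B + 1"]) auto
qed

text \<open>\<open>smooth_fun\<close> only controls the directional derivative in each fixed
  direction. Since the derivative is linear in the direction, the bounds for the finitely many basis
  directions add up to one that is uniform in \<open>v\<close>.\<close>

lemma smooth_fun_derivative_Lipschitz_at_zero:
  fixes f :: "'a::euclidean_space \<Rightarrow> real"
  assumes "smooth_fun f"
  shows "\<exists>K>0. \<exists>\<delta>>0. \<forall>z v. norm z \<le> \<delta> \<longrightarrow>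
    \<bar>frechet_derivative f (at z) v - frechet_derivative f (at 0) v\<bar> \<le> K * norm z * norm v"
proof -
  let ?D = "\<lambda>z. frechet_derivative f (at z)"
  have lin: "linear (?D z)" for z
    using smooth_fun_has_derivative[OF assms] has_derivative_linear by blast
  have "\<forall>b. \<exists>K>0. \<forall>\<^sub>F z in nhds 0. norm (?D z b - ?D 0 b) \<le> K * norm z"
    using has_derivative_imp_local_Lipschitz_at_zero
      smooth_fun_has_derivative smooth_fun_frechet_derivative assms by blast
  then obtain K where K: "\<And>b. K b > 0" "\<And>b. \<forall>\<^sub>F z in nhds 0. norm (?D z b - ?D 0 b) \<le> K b * norm z"
    by metis
  have "\<forall>\<^sub>F z in nhds 0. \<forall>b\<in>Basis. norm (?D z b - ?D 0 b) \<le> K b * norm z"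
    using K(2) by (intro eventually_ball_finite) auto
  then obtain d where d: "d > 0"
    "\<And>z b. dist z 0 < d \<Longrightarrow> b \<in> Basis \<Longrightarrow> norm (?D z b - ?D 0 b) \<le> K b * norm z"
    unfolding eventually_nhds_metric by blast
  have "\<bar>?D z v - ?D 0 v\<bar> \<le> (\<Sum>b\<in>Basis. K b) * norm z * norm v" if "norm z \<le> d / 2" for z v
  proof -
    have *: "?D y v = (\<Sum>b\<in>Basis. (v \<bullet> b) * ?D y b)" for y
    proof -
      have "?D y v = ?D y (\<Sum>b\<in>Basis. (v \<bullet> b) *\<^sub>R b)"
        by (simp add: euclidean_representation)
      also have "\<dots> = (\<Sum>b\<in>Basis. (v \<bullet> b) * ?D y b)"
        using lin[of y] by (simp add: linear_sum linear_scale)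
      finally show ?thesis .
    qed
    have "\<bar>?D z v - ?D 0 v\<bar> = \<bar>\<Sum>b\<in>Basis. (v \<bullet> b) * (?D z b - ?D 0 b)\<bar>"
      by (simp add: * sum_subtractf right_diff_distrib)
    also have "\<dots> \<le> (\<Sum>b\<in>Basis. norm v * (K b * norm z))"
    proof (rule order_trans[OF sum_abs], rule sum_mono)
      fix b :: 'a assume b: "b \<in> Basis"
      have "\<bar>?D z b - ?D 0 b\<bar> \<le> K b * norm z"
        using d(2)[of z b] b that d(1) by simp
      then show "\<bar>(v \<bullet> b) * (?D z b - ?D 0 b)\<bar> \<le> norm v * (K b * norm z)"
        unfolding abs_mult using Basis_le_norm[OF b, of v] by (intro mult_mono) auto
    qed
    also have "\<dots> = (\<Sum>b\<in>Basis. K b) * norm z * norm v"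
      by (simp add: sum_distrib_left sum_distrib_right mult_ac)
    finally show ?thesis .
  qed
  moreover have "(\<Sum>b\<in>(Basis::'a set). K b) > 0"
    using K(1) by (intro sum_pos) auto
  ultimately show ?thesis
    using d(1) by (intro exI[of _ "\<Sum>b\<in>Basis. K b"] conjI exI[of _ "d / 2"]) auto
qed

text \<open>Mean value inequality for \<open>f\<close> minus its linearisation at 0, whose
  derivative on the ball of radius \<rho> has norm at most \<open>K * \<rho>\<close>. With
  \<open>z' = 0\<close> and \<open>\<rho> = norm z\<close> this is the quadratic Taylor remainder;
  for general \<open>z'\<close> it says that the remainder has a small Lipschitz constant.\<close>

lemma smooth_fun_linearization_Lipschitz:
  fixes f :: "'a::euclidean_space \<Rightarrow> real"
  assumes "smooth_fun f"
  shows "\<exists>K>0. \<exists>\<delta>>0. \<forall>\<rho> z z'. \<rho> \<le> \<delta> \<longrightarrow> norm z \<le> \<rho> \<longrightarrow> norm z' \<le> \<rho> \<longrightarrow>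
    \<bar>f z - f z' - frechet_derivative f (at 0) (z - z')\<bar> \<le> K * \<rho> * norm (z - z')"
proof -
  let ?D = "\<lambda>z. frechet_derivative f (at z)"
  obtain K \<delta> where K: "K > 0" "\<delta> > 0"
    "\<And>z v. norm z \<le> \<delta> \<Longrightarrow> \<bar>?D z v - ?D 0 v\<bar> \<le> K * norm z * norm v"
    using smooth_fun_derivative_Lipschitz_at_zero[OF assms] by blast
  have bl: "bounded_linear (?D z)" for z
    using smooth_fun_has_derivative[OF assms] has_derivative_bounded_linear by blast
  have "\<bar>f z - f z' - ?D 0 (z - z')\<bar> \<le> K * \<rho> * norm (z - z')"
    if *: "\<rho> \<le> \<delta>" "norm z \<le> \<rho>" "norm z' \<le> \<rho>" for \<rho> z z'
  proof -
    have "norm ((f z - ?D 0 z) - (f z' - ?D 0 z')) \<le> K * \<rho> * norm (z - z')"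
    proof (rule differentiable_bound[of "cball 0 \<rho>"])
      show "convex (cball (0::'a) \<rho>)" by simp
      show "z \<in> cball 0 \<rho>" "z' \<in> cball 0 \<rho>" using * by auto
      fix y :: 'a assume y: "y \<in> cball 0 \<rho>"
      show "((\<lambda>z. f z - ?D 0 z) has_derivative (\<lambda>v. ?D y v - ?D 0 v)) (at y within cball 0 \<rho>)"
        by (intro derivative_intros has_derivative_at_withinI[OF smooth_fun_has_derivative[OF assms]]
            bounded_linear.has_derivative[OF bl] has_derivative_ident)
      have "\<bar>?D y v - ?D 0 v\<bar> \<le> K * \<rho> * norm v" for v
      proof -
        have "\<bar>?D y v - ?D 0 v\<bar> \<le> K * norm y * norm v"
          using K(3) y * by auto
        also have "\<dots> \<le> K * \<rho> * norm v"
          using y K(1) by (intro mult_right_mono mult_left_mono) auto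
        finally show ?thesis .
      qed
      then show "onorm (\<lambda>v. ?D y v - ?D 0 v) \<le> K * \<rho>"
        by (intro onorm_le) auto
    qed
    moreover have "?D 0 (z - z') = ?D 0 z - ?D 0 z'"
      using bl bounded_linear.linear linear_diff by blast
    ultimately show ?thesis by (simp add: algebra_simps)
  qed
  then show ?thesis using K(1,2) by blast
qed

section \<open>Zeros of perturbed maps\<close>

text \<open>Newton's method with the derivative frozen at the approximate zero.\<close>

lemma perturbed_zero_branch:
  fixes G :: "real \<Rightarrow> 'a::euclidean_space \<Rightarrow> 'a"
  assumes lin: "linear M" and inj: "inj M"
    and lip: "\<And>\<eta>. \<eta> > 0 \<Longrightarrow> \<exists>\<rho>>0. \<exists>\<epsilon>>0. \<forall>\<mu> w w'. 0 < \<mu> \<longrightarrow> \<mu> < \<epsilon> \<longrightarrow> w \<in> cball d \<rho> \<longrightarrow> w' \<in> cball d \<rho> \<longrightarrow>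
            norm (G \<mu> w - G \<mu> w' - M (w - w')) \<le> \<eta> * norm (w - w')"
    and approx: "\<exists>K\<ge>0. \<exists>\<epsilon>>0. \<forall>\<mu>. 0 < \<mu> \<longrightarrow> \<mu> < \<epsilon> \<longrightarrow> norm (G \<mu> d) \<le> K * \<mu>"
    and cont: "\<And>w. continuous_on {0<..} (\<lambda>\<mu>. G \<mu> w)"
  shows "\<exists>\<rho>>0. \<exists>\<epsilon>>0. \<exists>K\<ge>0. \<exists>X. continuous_on {0<..<\<epsilon>} X \<and>
    (\<forall>\<mu>\<in>{0<..<\<epsilon>}. G \<mu> (X \<mu>) = 0 \<and> norm (X \<mu> - d) \<le> K * \<mu> \<and>
       (\<forall>w\<in>cball d \<rho>. G \<mu> w = 0 \<longrightarrow> w = X \<mu>))"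
proof -
  obtain N where N: "linear N" "\<And>x. N (M x) = x"
    using linear_injective_left_inverse[OF lin inj] by (metis comp_apply id_apply)
  have MN: "M (N x) = x" for x
    using linear_injective_imp_surjective[OF lin inj] N(2) by (metis surjD)
  obtain B where B: "B > 0" "\<And>x. norm (N x) \<le> B * norm x"
    using linear_bounded_pos[OF N(1)] by blast
  \<comment> \<open>\<open>B\<close> bounds the inverse \<open>N\<close>, so the tolerance
    \<open>1 / (2 * B)\<close> makes the Newton map \<open>w - N (G \<mu> w)\<close> contract by the
    factor 1/2.\<close>
  obtain \<rho> \<epsilon>1 where \<rho>: "\<rho> > 0" "\<epsilon>1 > 0"
    "\<And>\<mu> w w'. 0 < \<mu> \<Longrightarrow> \<mu> < \<epsilon>1 \<Longrightarrow> w \<in> cball d \<rho> \<Longrightarrow> w' \<in> cball d \<rho> \<Longrightarrow>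
            norm (G \<mu> w - G \<mu> w' - M (w - w')) \<le> 1 / (2 * B) * norm (w - w')"
    using lip[of "1 / (2 * B)"] B(1) by (auto simp: zero_less_divide_iff)
  obtain K \<epsilon>2 where K: "K \<ge> 0" "\<epsilon>2 > 0" "\<And>\<mu>. 0 < \<mu> \<Longrightarrow> \<mu> < \<epsilon>2 \<Longrightarrow> norm (G \<mu> d) \<le> K * \<mu>"
    using approx by blast
  \<comment> \<open>The last bound keeps the first Newton step from \<open>d\<close> below
    \<open>\<rho> / 2\<close>; together with the contraction factor 1/2 the ball is mapped into
    itself. The summand 1 covers \<open>K = 0\<close>.\<close>
  define \<epsilon> where "\<epsilon> = min (min \<epsilon>1 \<epsilon>2) (\<rho> / (2 * (B * K + 1)))"
  have \<epsilon>: "\<epsilon> > 0" "\<epsilon> \<le> \<epsilon>1" "\<epsilon> \<le> \<epsilon>2" "\<epsilon> \<le> \<rho> / (2 * (B * K + 1))"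
    using \<rho> K B(1) by (auto simp: \<epsilon>_def add_nonneg_pos)
  have contr: "norm ((w - N (G \<mu> w)) - (w' - N (G \<mu> w'))) \<le> 1 / 2 * norm (w - w')"
    if "0 < \<mu>" "\<mu> < \<epsilon>" "w \<in> cball d \<rho>" "w' \<in> cball d \<rho>" for \<mu> w w'
  proof -
    have "(w - N (G \<mu> w)) - (w' - N (G \<mu> w')) = - N (G \<mu> w - G \<mu> w' - M (w - w'))"
      using N by (simp add: linear_diff)
    then have "norm ((w - N (G \<mu> w)) - (w' - N (G \<mu> w'))) \<le> B * norm (G \<mu> w - G \<mu> w' - M (w - w'))"
      using B(2) by (metis norm_minus_cancel)
    also have "\<dots> \<le> B * (1 / (2 * B) * norm (w - w'))"
      using \<rho>(3)[of \<mu> w w'] that \<epsilon> B(1) by (intro mult_left_mono) auto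
    also have "\<dots> = 1 / 2 * norm (w - w')" using B(1) by simp
    finally show ?thesis .
  qed
  \<comment> \<open>This inverse Lipschitz bound gives three conclusions at once: uniqueness of the
    zero, its continuity in \<mu>, and its distance from \<open>d\<close>.\<close>
  have expand: "norm (w - w') \<le> 2 * B * norm (G \<mu> w - G \<mu> w')"
    if "0 < \<mu>" "\<mu> < \<epsilon>" "w \<in> cball d \<rho>" "w' \<in> cball d \<rho>" for \<mu> w w'
  proof -
    have "w - w' = ((w - N (G \<mu> w)) - (w' - N (G \<mu> w'))) + N (G \<mu> w - G \<mu> w')"
      using N by (simp add: linear_diff)
    then have "norm (w - w') \<le> norm ((w - N (G \<mu> w)) - (w' - N (G \<mu> w'))) + norm (N (G \<mu> w - G \<mu> w'))"
      by (metis norm_triangle_ineq)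
    then show ?thesis
      using contr[OF that] B(2)[of "G \<mu> w - G \<mu> w'"] by linarith
  qed
  have ex: "\<exists>w\<in>cball d \<rho>. G \<mu> w = 0" if \<mu>: "0 < \<mu>" "\<mu> < \<epsilon>" for \<mu>
  proof -
    have "\<exists>!w. w \<in> cball d \<rho> \<and> w - N (G \<mu> w) = w"
    proof (rule Banach_fix[where c = "1/2"])
      show "complete (cball d \<rho>)" by (simp add: complete_eq_closed)
      show "cball d \<rho> \<noteq> {}" using \<rho> by auto
      show "dist (w - N (G \<mu> w)) (w' - N (G \<mu> w')) \<le> 1 / 2 * dist w w'"
        if "w \<in> cball d \<rho>" "w' \<in> cball d \<rho>" for w w'
        using contr[of \<mu> w w'] \<mu> that by (simp add: dist_norm)
      show "(\<lambda>w. w - N (G \<mu> w)) ` cball d \<rho> \<subseteq> cball d \<rho>"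
      proof (rule image_subsetI)
        fix w assume w: "w \<in> cball d \<rho>"
        have 1: "norm ((w - N (G \<mu> w)) - (d - N (G \<mu> d))) \<le> 1 / 2 * \<rho>"
          using contr[of \<mu> w d] \<mu> w \<rho> by (auto simp: dist_norm norm_minus_commute)
        have "norm (N (G \<mu> d)) \<le> B * (K * \<mu>)"
          using B(2)[of "G \<mu> d"] K(3)[of \<mu>] \<mu> \<epsilon> B(1) by (smt (verit) mult_left_mono)
        also have "\<dots> \<le> (B * K + 1) * \<epsilon>"
          using \<mu> B(1) K(1) by (simp add: distrib_right mult_left_mono add_increasing2)
        also have "\<dots> \<le> \<rho> / 2"
        proof -
          have "B * K + 1 > 0" using B(1) K(1) by (simp add: add_nonneg_pos)
          then show ?thesis using \<epsilon>(4) by (simp add: field_simps)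
        qed
        finally have 2: "norm (N (G \<mu> d)) \<le> \<rho> / 2" .
        have "norm ((w - N (G \<mu> w)) - d) \<le> norm ((w - N (G \<mu> w)) - (d - N (G \<mu> d))) + norm (N (G \<mu> d))"
          using norm_triangle_ineq4[of "(w - N (G \<mu> w)) - (d - N (G \<mu> d))" "N (G \<mu> d)"]
          by (simp add: algebra_simps)
        then show "w - N (G \<mu> w) \<in> cball d \<rho>"
          using 1 2 by (simp add: dist_norm norm_minus_commute)
      qed
    qed auto
    then obtain w where "w \<in> cball d \<rho>" "N (G \<mu> w) = 0" by auto
    moreover have "G \<mu> w = 0"
      using MN[of "G \<mu> w"] \<open>N (G \<mu> w) = 0\<close> linear_0[OF lin] by simp
    ultimately show ?thesis by blast
  qed
  then obtain X where X: "\<And>\<mu>. 0 < \<mu> \<Longrightarrow> \<mu> < \<epsilon> \<Longrightarrow> X \<mu> \<in> cball d \<rho> \<and> G \<mu> (X \<mu>) = 0"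
    by metis
  \<comment> \<open>Both \<open>X \<mu>\<close> and \<open>X \<nu>\<close> are inserted into the
    same map \<open>G \<mu>\<close>. As \<open>G \<mu> (X \<mu>) = 0\<close>, their distance is
    bounded by \<open>G \<mu> (X \<nu>)\<close>, which tends to \<open>G \<nu> (X \<nu>) = 0\<close>
    by continuity in \<mu> at a fixed point.\<close>
  have "continuous_on {0<..<\<epsilon>} X"
    unfolding continuous_on_def
  proof
    fix \<nu> assume \<nu>: "\<nu> \<in> {0<..<\<epsilon>}"
    let ?F = "at \<nu> within {0<..<\<epsilon>}"
    have "((\<lambda>\<mu>. G \<mu> (X \<nu>)) \<longlongrightarrow> G \<nu> (X \<nu>)) ?F"
      using cont[of "X \<nu>"] \<nu> by (meson continuous_on_def continuous_on_subset greaterThanLessThan_iff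
          greaterThan_iff subsetI)
    then have lim: "((\<lambda>\<mu>. 2 * B * norm (G \<mu> (X \<nu>))) \<longlongrightarrow> 0) ?F"
      using X \<nu> by (auto intro!: tendsto_eq_intros)
    have "norm (X \<mu> - X \<nu>) \<le> 2 * B * norm (G \<mu> (X \<nu>))" if "\<mu> \<in> {0<..<\<epsilon>}" for \<mu>
      using expand[of \<mu> "X \<mu>" "X \<nu>"] X[of \<mu>] X[of \<nu>] that \<nu> by simp
    then have "\<forall>\<^sub>F \<mu> in ?F. norm (X \<mu> - X \<nu>) \<le> 2 * B * norm (G \<mu> (X \<nu>))"
      by (auto simp: eventually_at_filter intro!: always_eventually)
    then have "((\<lambda>\<mu>. X \<mu> - X \<nu>) \<longlongrightarrow> 0) ?F"
      using lim by (rule Lim_null_comparison)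
    then show "(X \<longlongrightarrow> X \<nu>) ?F"
      using Lim_null by blast
  qed
  moreover have "norm (X \<mu> - d) \<le> 2 * B * K * \<mu>" if "\<mu> \<in> {0<..<\<epsilon>}" for \<mu>
  proof -
    have "norm (X \<mu> - d) \<le> 2 * B * norm (G \<mu> d)"
      using expand[of \<mu> "X \<mu>" d] X[of \<mu>] that \<rho> by auto
    also have "\<dots> \<le> 2 * B * (K * \<mu>)"
      using K(3)[of \<mu>] that \<epsilon> B(1) by (intro mult_left_mono) auto
    finally show ?thesis by simp
  qed
  moreover have "w = X \<mu>" if "\<mu> \<in> {0<..<\<epsilon>}" "w \<in> cball d \<rho>" "G \<mu> w = 0" for \<mu> w
    using expand[of \<mu> w "X \<mu>"] X[of \<mu>] that by simp
  ultimately show ?thesis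
    using \<rho>(1) \<epsilon>(1) K(1) B(1) X
    by (intro exI[of _ \<rho>] exI[of _ \<epsilon>] exI[of _ "2 * B * K"] exI[of _ X] conjI ballI impI) auto
qed

section \<open>Feedforward networks at a bifurcation\<close>

text \<open>A path of maximal length among the cells violating \<open>P\<close> would close up to a cycle.\<close>

lemma feedforward_induct [consumes 1, case_names step]:
  fixes sig :: "'s \<Rightarrow> 'c::finite \<Rightarrow> 'c"
  assumes ff: "feedforward sig"
    and step: "\<And>p. (\<And>s. sig s p \<noteq> p \<Longrightarrow> P (sig s p)) \<Longrightarrow> P p"
  shows "P p"
proof (rule ccontr)
  assume "\<not> P p"
  let ?Q = "\<lambda>ps. is_path sig ps \<and> ps \<noteq> [] \<and> (\<forall>q\<in>set ps. \<not> P q)"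
  have "?Q [p]"
    using \<open>\<not> P p\<close> by (simp add: is_path_def)
  moreover have "length ps \<le> CARD('c)" if "?Q ps" for ps
    using that card_mono[of UNIV "set ps"] by (simp add: is_path_def distinct_card)
  ultimately obtain ps where ps: "?Q ps" and longest: "\<And>qs. ?Q qs \<Longrightarrow> length qs \<le> length ps"
    using ex_has_greatest_nat[of ?Q "[p]" length "Suc CARD('c)"] le_imp_less_Suc by blast
  have "ps ! 0 \<in> set ps"
    using ps by auto
  then obtain s where s: "sig s (ps ! 0) \<noteq> ps ! 0" "\<not> P (sig s (ps ! 0))"
    using ps step by metis
  show False
  proof (cases "sig s (ps ! 0) \<in> set ps")
    case False
    have "is_path sig (sig s (ps ! 0) # ps)"
      unfolding is_path_def
    proof (intro conjI allI impI)
      show "distinct (sig s (ps ! 0) # ps)"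
        using ps False by (simp add: is_path_def)
      fix j assume "Suc j < length (sig s (ps ! 0) # ps)"
      then show "\<exists>t. sig t ((sig s (ps ! 0) # ps) ! Suc j) = (sig s (ps ! 0) # ps) ! j"
        using ps by (cases j) (auto simp: is_path_def)
    qed
    then show False
      using longest[of "sig s (ps ! 0) # ps"] ps s by simp
  next
    case True
    then obtain k where k: "k < length ps" "ps ! k = sig s (ps ! 0)"
      by (auto simp: in_set_conv_nth)
    \<comment> \<open>The new cell \<open>sig s (ps ! 0)\<close> already occurs at position
      \<open>k\<close>, so the prefix ending there closes up through \<open>s\<close>. Only
      \<open>k = 0\<close> is allowed in a feedforward network, but then \<open>s\<close> would fix
      the head of the path.\<close>
    have "is_cycle sig (take (Suc k) ps)"
      unfolding is_cycle_def
    proof (intro conjI exI[of _ s])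
      show "is_path sig (take (Suc k) ps)"
        using ps by (auto simp: is_path_def)
      show "sig s (take (Suc k) ps ! 0) = last (take (Suc k) ps)"
        using k last_snoc[of "take k ps" "ps ! k"] unfolding take_Suc_conv_app_nth[OF k(1), symmetric] by simp
    qed (use ps in auto)
    then have "length (take (Suc k) ps) < 2"
      using ff unfolding feedforward_def by blast
    then have "k = 0" using k by simp
    then show False using k s by simp
  qed
qed

section \<open>Taylor expansion of the response function, in general and on the diagonal\<close>

lemma frechet_derivative_eq_coefs:
  fixes f :: "(real^'s::finite) \<times> real \<Rightarrow> real"
  assumes "smooth_fun f"
  shows "frechet_derivative f (at 0) (v, lam) = (\<Sum>s\<in>UNIV. coef_a f s * v $ s) + coef_l f * lam"
proof -
  let ?D = "frechet_derivative f (at 0)"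
  have lin: "linear ?D"
    using smooth_fun_has_derivative[OF assms] has_derivative_linear by blast
  have "v = (\<Sum>s\<in>UNIV. (v $ s) *\<^sub>R axis s 1)"
    using basis_expansion[of v] by (simp add: scalar_mult_eq_scaleR)
  then have "(v, lam) = (\<Sum>s\<in>UNIV. (v $ s) *\<^sub>R (axis s 1, 0)) + lam *\<^sub>R (0, 1)"
    by (simp add: prod_eq_iff fst_sum snd_sum)
  then have "?D (v, lam) = (\<Sum>s\<in>UNIV. (v $ s) * ?D (axis s 1, 0)) + lam * ?D (0, 1)"
    by (simp add: linear_add[OF lin] linear_sum[OF lin] linear_scale[OF lin] del: scaleR_Pair add_Pair)
  then show ?thesis
    by (simp add: coef_a_def coef_l_def mult.commute)
qed

text \<open>The factor 2 undoes the 1/2 in \<open>coef_f2\<close>: the double sum is the coefficient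
  of \<open>y\<^sup>2\<close> in the expansion of \<open>f\<close> along the diagonal, which governs
  the maximal cells.\<close>

lemma frechet_derivative_diagonal_eq:
  fixes f :: "(real^'s::finite) \<times> real \<Rightarrow> real"
  assumes "smooth_fun f"
  shows "frechet_derivative (\<lambda>z. frechet_derivative f (at z) (1, 0)) (at 0) (1, 0)
    = 2 * (\<Sum>s\<in>UNIV. \<Sum>t\<in>UNIV. coef_f2 f s t)"
proof -
  let ?D = "\<lambda>z. frechet_derivative f (at z)"
  let ?h = "\<lambda>t z. ?D z (axis t 1, 0)"
  have lin: "linear (?D z)" for z
    using smooth_fun_has_derivative[OF assms] has_derivative_linear by blast
  have one: "(1::real^'s, 0::real) = (\<Sum>t\<in>UNIV. (axis t 1, 0))"
    using basis_expansion[of "1::real^'s"] by (simp add: prod_eq_iff fst_sum snd_sum)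
  have h: "(?h t has_derivative frechet_derivative (?h t) (at 0)) (at 0)" for t
    by (rule smooth_fun_has_derivative[OF smooth_fun_frechet_derivative[OF assms]])
  have hsum: "((\<lambda>z. ?D z (1, 0)) has_derivative (\<lambda>v. \<Sum>t\<in>UNIV. frechet_derivative (?h t) (at 0) v)) (at 0)"
    unfolding one linear_sum[OF lin] by (intro has_derivative_sum h)
  have "frechet_derivative (\<lambda>z. ?D z (1, 0)) (at 0) (1, 0)
      = (\<Sum>t\<in>UNIV. frechet_derivative (?h t) (at 0) (1, 0))"
    using fun_cong[OF frechet_derivative_at[OF hsum], of "(1, 0)"] by simp
  also have "\<dots> = (\<Sum>t\<in>UNIV. \<Sum>s\<in>UNIV. frechet_derivative (?h t) (at 0) (axis s 1, 0))"
    unfolding one by (intro sum.cong refl linear_sum has_derivative_linear[OF h])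
  also have "\<dots> = (\<Sum>s\<in>UNIV. \<Sum>t\<in>UNIV. 2 * coef_f2 f s t)"
    by (subst sum.swap) (simp add: coef_f2_def)
  finally show ?thesis by (simp add: sum_distrib_left)
qed

text \<open>By \<open>crit\<close> the derivative \<open>h\<close> of \<open>f\<close> along the
  diagonal vanishes at 0, and its linear part is \<open>2 * S * \<xi> + \<beta> * lam\<close>. Hence
  \<open>f - S * y\<^sup>2\<close> on the diagonal has a derivative in \<open>y\<close> of order
  \<open>\<xi>\<^sup>2 + \<bar>lam\<bar>\<close>, and the mean value inequality applies. The bound
  weighs \<open>lam\<close> like \<open>y\<^sup>2\<close>, as the scaling
  \<open>lam = sg * \<mu>\<^sup>2\<close>, \<open>y = \<mu> * w\<close> requires.\<close>

lemma diagonal_quadratic_estimate: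
  fixes f :: "(real^'s::finite) \<times> real \<Rightarrow> real"
  assumes smooth: "smooth_fun f" and crit: "(\<Sum>s\<in>UNIV. coef_a f s) = 0"
  defines "S \<equiv> (\<Sum>s\<in>UNIV. \<Sum>t\<in>UNIV. coef_f2 f s t)"
  shows "\<exists>K>0. \<exists>\<delta>>0. \<forall>\<rho> lam y y'. \<rho> \<le> \<delta> \<longrightarrow> \<bar>lam\<bar> \<le> \<delta> \<longrightarrow> \<bar>y\<bar> \<le> \<rho> \<longrightarrow> \<bar>y'\<bar> \<le> \<rho> \<longrightarrow>
    \<bar>f (y *\<^sub>R 1, lam) - f (y' *\<^sub>R 1, lam) - S * (y\<^sup>2 - y'\<^sup>2)\<bar> \<le> K * (\<rho>\<^sup>2 + \<bar>lam\<bar>) * \<bar>y - y'\<bar>"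
proof -
  define h where "h = (\<lambda>z. frechet_derivative f (at z) (1, 0))"
  have h: "smooth_fun h"
    unfolding h_def by (rule smooth_fun_frechet_derivative[OF smooth])
  have h0: "h 0 = 0"
    unfolding h_def frechet_derivative_eq_coefs[OF smooth] using crit by simp
  have lin: "linear (frechet_derivative h (at 0))"
    using smooth_fun_has_derivative[OF h] has_derivative_linear by blast
  obtain K \<delta> where K: "K > 0" "\<delta> > 0" "\<And>\<rho> z z'. \<rho> \<le> \<delta> \<Longrightarrow> norm z \<le> \<rho> \<Longrightarrow> norm z' \<le> \<rho> \<Longrightarrow>
      \<bar>h z - h z' - frechet_derivative h (at 0) (z - z')\<bar> \<le> K * \<rho> * norm (z - z')"
    using smooth_fun_linearization_Lipschitz[OF h] by blast
  define n where "n = norm (1 :: real^'s)"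
  define \<beta> where "\<beta> = frechet_derivative h (at 0) (0, 1)"
  \<comment> \<open>The second bound keeps \<open>(\<xi> *\<^sub>R 1, lam)\<close> within radius
    \<delta>; the bound 1 gives \<open>lam\<^sup>2 \<le> \<bar>lam\<bar>\<close>.\<close>
  define \<delta>' where "\<delta>' = min 1 (\<delta> / (n + 1))"
  have n: "n \<ge> 0" by (simp add: n_def)
  have \<delta>': "\<delta>' > 0" "\<delta>' \<le> 1" "\<delta>' * (n + 1) \<le> \<delta>"
  proof -
    show "\<delta>' > 0" "\<delta>' \<le> 1" using K n by (auto simp: \<delta>'_def)
    have "\<delta>' \<le> \<delta> / (n + 1)" by (simp add: \<delta>'_def)
    then show "\<delta>' * (n + 1) \<le> \<delta>" using n by (simp add: pos_le_divide_eq)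
  qed
  \<comment> \<open>The first summand comes from the quadratic remainder of \<open>h\<close> via
    \<open>(a + b)\<^sup>2 \<le> 2 * a\<^sup>2 + 2 * b\<^sup>2\<close>, the second from the part of
    the linearisation of \<open>h\<close> that depends on \<open>lam\<close>.\<close>
  define C where "C = 2 * K * (n\<^sup>2 + 1) + \<bar>\<beta>\<bar>"
  have deriv: "\<bar>h (\<xi> *\<^sub>R 1, lam) - 2 * S * \<xi>\<bar> \<le> C * (\<xi>\<^sup>2 + \<bar>lam\<bar>)"
    if *: "\<bar>\<xi>\<bar> \<le> \<delta>'" "\<bar>lam\<bar> \<le> \<delta>'" for \<xi> lam
  proof -
    define z where "z = (\<xi> *\<^sub>R (1 :: real^'s), lam)"
    have nz: "norm z \<le> \<bar>\<xi>\<bar> * n + \<bar>lam\<bar>"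
      unfolding z_def n_def using norm_Pair_le[of "\<xi> *\<^sub>R (1 :: real^'s)" lam] by simp
    also have "\<dots> \<le> \<delta>' * n + \<delta>'"
      using * n by (intro add_mono mult_right_mono)
    finally have "norm z \<le> \<delta>"
      using \<delta>' by (simp add: algebra_simps)
    then have 1: "\<bar>h z - frechet_derivative h (at 0) z\<bar> \<le> K * norm z * norm z"
      using K(3)[of "norm z" z 0] h0 by simp
    have "(norm z)\<^sup>2 \<le> (\<bar>\<xi>\<bar> * n + \<bar>lam\<bar>)\<^sup>2"
      using nz by (intro power_mono) auto
    also have "\<dots> \<le> 2 * (\<bar>\<xi>\<bar> * n)\<^sup>2 + 2 * \<bar>lam\<bar>\<^sup>2"
      using sum_squares_bound[of "\<bar>\<xi>\<bar> * n" "\<bar>lam\<bar>"] by (simp add: power2_sum)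
    also have "\<dots> \<le> 2 * (n\<^sup>2 * \<xi>\<^sup>2) + 2 * \<bar>lam\<bar>"
    proof -
      have "\<bar>lam\<bar>\<^sup>2 \<le> 1 * \<bar>lam\<bar>"
        unfolding power2_eq_square using * \<delta>' by (intro mult_right_mono) auto
      then show ?thesis by (simp add: power_mult_distrib mult.commute)
    qed
    also have "\<dots> \<le> 2 * (n\<^sup>2 + 1) * (\<xi>\<^sup>2 + \<bar>lam\<bar>)"
      by (simp add: algebra_simps)
    finally have "K * (norm z)\<^sup>2 \<le> K * (2 * (n\<^sup>2 + 1) * (\<xi>\<^sup>2 + \<bar>lam\<bar>))"
      using K(1) by (intro mult_left_mono) auto
    then have "K * norm z * norm z \<le> 2 * K * (n\<^sup>2 + 1) * (\<xi>\<^sup>2 + \<bar>lam\<bar>)"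
      by (simp only: power2_eq_square mult_ac)
    moreover have "frechet_derivative h (at 0) z = 2 * S * \<xi> + \<beta> * lam"
    proof -
      have "z = \<xi> *\<^sub>R (1, 0) + lam *\<^sub>R (0, 1)" by (simp add: z_def)
      then have "frechet_derivative h (at 0) z = \<xi> * frechet_derivative h (at 0) (1, 0) + lam * \<beta>"
        by (simp add: linear_add[OF lin] linear_scale[OF lin] \<beta>_def del: scaleR_Pair add_Pair)
      then show ?thesis
        using frechet_derivative_diagonal_eq[OF smooth] by (simp add: h_def S_def mult.commute)
    qed
    moreover have "\<bar>\<beta> * lam\<bar> \<le> \<bar>\<beta>\<bar> * (\<xi>\<^sup>2 + \<bar>lam\<bar>)"
      unfolding abs_mult by (intro mult_left_mono) auto
    ultimately show ?thesis
      using 1 unfolding z_def[symmetric] C_def distrib_right[of _ "\<bar>\<beta>\<bar>"] by linarith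
  qed
  have "\<bar>f (y *\<^sub>R 1, lam) - f (y' *\<^sub>R 1, lam) - S * (y\<^sup>2 - y'\<^sup>2)\<bar> \<le> C * (\<rho>\<^sup>2 + \<bar>lam\<bar>) * \<bar>y - y'\<bar>"
    if *: "\<rho> \<le> \<delta>'" "\<bar>lam\<bar> \<le> \<delta>'" "\<bar>y\<bar> \<le> \<rho>" "\<bar>y'\<bar> \<le> \<rho>" for \<rho> lam y y'
  proof -
    have "norm ((f (y *\<^sub>R 1, lam) - S * y\<^sup>2) - (f (y' *\<^sub>R 1, lam) - S * y'\<^sup>2)) \<le> C * (\<rho>\<^sup>2 + \<bar>lam\<bar>) * norm (y - y')"
    proof (rule field_differentiable_bound[of "cball 0 \<rho>"])
      show "y \<in> cball 0 \<rho>" "y' \<in> cball 0 \<rho>" using * by auto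
      fix \<xi> :: real assume \<xi>: "\<xi> \<in> cball 0 \<rho>"
      have D: "(f has_derivative frechet_derivative f (at (\<xi> *\<^sub>R 1, lam))) (at (\<xi> *\<^sub>R 1, lam))"
        by (rule smooth_fun_has_derivative[OF smooth])
      have "((\<lambda>y. (y *\<^sub>R (1 :: real^'s), lam)) has_derivative (\<lambda>t. (t *\<^sub>R 1, 0))) (at \<xi>)"
        by (auto intro!: derivative_eq_intros)
      from has_derivative_compose[OF this D]
      have "((\<lambda>y. f (y *\<^sub>R 1, lam)) has_derivative
          (\<lambda>t. frechet_derivative f (at (\<xi> *\<^sub>R 1, lam)) (t *\<^sub>R 1, 0))) (at \<xi>)" .
      moreover have "frechet_derivative f (at (\<xi> *\<^sub>R 1, lam)) (t *\<^sub>R 1, 0) = h (\<xi> *\<^sub>R 1, lam) * t" for t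
        using linear_scale[OF has_derivative_linear[OF D], of t "(1, 0)"] by (simp add: h_def)
      ultimately have "((\<lambda>y. f (y *\<^sub>R 1, lam)) has_field_derivative h (\<xi> *\<^sub>R 1, lam)) (at \<xi>)"
        by (simp add: has_field_derivative_def)
      then have "((\<lambda>y. f (y *\<^sub>R 1, lam) - S * y\<^sup>2) has_field_derivative h (\<xi> *\<^sub>R 1, lam) - 2 * S * \<xi>) (at \<xi>)"
        by (auto intro!: derivative_eq_intros)
      then show "((\<lambda>y. f (y *\<^sub>R 1, lam) - S * y\<^sup>2) has_field_derivative h (\<xi> *\<^sub>R 1, lam) - 2 * S * \<xi>)
          (at \<xi> within cball 0 \<rho>)"
        by (rule has_field_derivative_at_within)
      have "\<xi>\<^sup>2 \<le> \<rho>\<^sup>2" using \<xi> by (intro abs_le_square_iff[THEN iffD1]) auto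
      then have "C * (\<xi>\<^sup>2 + \<bar>lam\<bar>) \<le> C * (\<rho>\<^sup>2 + \<bar>lam\<bar>)"
        using K(1) by (intro mult_left_mono) (auto simp: C_def)
      then show "norm (h (\<xi> *\<^sub>R 1, lam) - 2 * S * \<xi>) \<le> C * (\<rho>\<^sup>2 + \<bar>lam\<bar>)"
        using deriv[of \<xi> lam] \<xi> * by auto
    qed simp
    then show ?thesis by (simp add: algebra_simps)
  qed
  moreover have "C > 0"
    using K(1) unfolding C_def by (intro add_pos_nonneg mult_pos_pos add_nonneg_pos) auto
  ultimately show ?thesis
    using \<delta>'(1) by (intro exI[of _ C] conjI exI[of _ \<delta>']) blast+
qed

lemma norm_le_card_mult:
  fixes v :: "real^'n::finite" and B :: real
  assumes "\<And>p. \<bar>v $ p\<bar> \<le> B"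
  shows "norm v \<le> CARD('n) * B"
proof -
  have "norm v \<le> (\<Sum>p\<in>UNIV. \<bar>v $ p\<bar>)"
    by (rule norm_le_l1_cart)
  also have "\<dots> \<le> (\<Sum>p\<in>(UNIV::'n set). B)"
    by (intro sum_mono assms)
  finally show ?thesis by simp
qed

text \<open>One argument serves both sides of the bifurcation point. The leading-order equation of a
  maximal cell is \<open>Q * y\<^sup>2 + coef_l f * lam = 0\<close>, and \<open>side\<close> says
  that it has two real nonzero roots when \<open>lam\<close> has the sign of
  \<open>sg\<close>.\<close>

locale critical_feedforward =
  fixes sig :: "'s::finite \<Rightarrow> 'c::finite \<Rightarrow> 'c"
    and f :: "(real^'s) \<times> real \<Rightarrow> real"
    and sg :: real
  assumes ff: "feedforward sig"
    and smooth: "smooth_fun f"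
    and f00: "f (0, 0) = 0"
    and crit_max: "maximal_cell sig p \<Longrightarrow> critical sig f p"
    and noncrit: "\<not> maximal_cell sig p \<Longrightarrow> \<not> critical sig f p"
    and sg: "\<bar>sg\<bar> = 1"
    and side: "sg * coef_l f / (\<Sum>s\<in>UNIV. \<Sum>t\<in>UNIV. coef_f2 f s t) < 0"
begin

definition Q :: real where
  "Q = (\<Sum>s\<in>UNIV. \<Sum>t\<in>UNIV. coef_f2 f s t)"

text \<open>The positive root of the rescaled leading-order equation
  \<open>Q * y\<^sup>2 + sg * coef_l f = 0\<close> of a maximal cell.\<close>

definition c :: real where
  "c = sqrt (- (sg * coef_l f / Q))"

text \<open>With \<open>d p = 2 * Q * D p\<close> this is the limit, as \<open>\<mu> \<rightarrow> 0\<close>, of the linearisation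
  at \<open>D\<close> of the rescaled cell equations.\<close>

definition cell_map :: "('c \<Rightarrow> real) \<Rightarrow> real^'c \<Rightarrow> real^'c" where
  "cell_map d v = (\<chi> p. if maximal_cell sig p then d p * v $ p
     else (\<Sum>s\<in>UNIV. coef_a f s * v $ sig s p))"

definition input :: "'c \<Rightarrow> real^'c \<Rightarrow> real^'s" where
  "input p x = (\<chi> s. x $ sig s p)"

section \<open>Linear algebra of the coefficient vectors\<close>

lemma Q_nonzero: "Q \<noteq> 0"
  using side by (auto simp: Q_def)

lemma c_pos: "c > 0"
  using side by (simp add: c_def Q_def)

lemma Q_c_squared: "Q * c\<^sup>2 = - (sg * coef_l f)"
proof -
  have "c\<^sup>2 = - (sg * coef_l f / Q)"
    using side by (simp add: c_def Q_def)
  then show ?thesis using Q_nonzero by (simp add: field_simps)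
qed

text \<open>A maximal cell exists: without one, induction along the network would prove the
  constantly false predicate. At such a cell every map is a self-input, so criticality is exactly
  this equation.\<close>

lemma sum_coef_a: "(\<Sum>s\<in>UNIV. coef_a f s) = 0"
proof -
  have "\<exists>p. maximal_cell sig p"
  proof (rule ccontr)
    assume *: "\<nexists>p. maximal_cell sig p"
    show False
      using ff
    proof (induction rule: feedforward_induct)
      case (step p)
      then show ?case using * by (auto simp: maximal_cell_def)
    qed
  qed
  then obtain p where p: "maximal_cell sig p" ..
  then have "Lset sig p = UNIV"
    by (auto simp: maximal_cell_def Lset_def)
  then show ?thesis
    using crit_max[OF p] by (simp add: critical_def)
qed

text \<open>All self-inputs carry the same value \<open>D p\<close>. Their total weight is the
  diagonal entry of the triangular linear system at \<open>p\<close>, nonzero precisely if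
  \<open>p\<close> is not critical.\<close>

lemma sum_coef_a_split:
  "(\<Sum>s\<in>UNIV. coef_a f s * D (sig s p)) =
    (\<Sum>s\<in>Lset sig p. coef_a f s) * D p + (\<Sum>t\<in>- Lset sig p. coef_a f t * D (sig t p))"
proof -
  have "(\<Sum>s\<in>UNIV. coef_a f s * D (sig s p)) =
      (\<Sum>s\<in>Lset sig p. coef_a f s * D (sig s p)) + (\<Sum>t\<in>- Lset sig p. coef_a f t * D (sig t p))"
    by (subst sum.union_disjoint[symmetric]) auto
  also have "(\<Sum>s\<in>Lset sig p. coef_a f s * D (sig s p)) = (\<Sum>s\<in>Lset sig p. coef_a f s * D p)"
    by (intro sum.cong) (auto simp: Lset_def)
  finally show ?thesis by (simp add: sum_distrib_right)
qed

text \<open>Clearing the denominator, which is nonzero at a non-critical cell, turns the recursion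
  into the homogeneous equation that the second case of \<open>cell_map\<close> encodes.\<close>

lemma Dcoeffs_iff:
  "D \<in> Dcoeffs sig f c \<longleftrightarrow>
    (\<forall>p. maximal_cell sig p \<longrightarrow> D p = c \<or> D p = - c) \<and>
    (\<forall>p. \<not> maximal_cell sig p \<longrightarrow> (\<Sum>s\<in>UNIV. coef_a f s * D (sig s p)) = 0)"
proof -
  have "(D p = - (\<Sum>t\<in>- Lset sig p. coef_a f t * D (sig t p)) / (\<Sum>s\<in>Lset sig p. coef_a f s)) \<longleftrightarrow>
      (\<Sum>s\<in>UNIV. coef_a f s * D (sig s p)) = 0" if "\<not> maximal_cell sig p" for p
  proof -
    have "(\<Sum>s\<in>Lset sig p. coef_a f s) \<noteq> 0"
      using noncrit[OF that] by (simp add: critical_def)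
    from nonzero_eq_divide_eq[OF this] show ?thesis
      unfolding sum_coef_a_split[of D p] by (simp only: mult.commute eq_neg_iff_add_eq_0)
  qed
  then show ?thesis by (simp add: Dcoeffs_def)
qed

lemma linear_cell_map: "linear (cell_map d)"
  by (rule linearI)
    (auto simp: cell_map_def vec_eq_iff algebra_simps sum.distrib sum_distrib_left)

text \<open>A kernel vector vanishes at \<open>p\<close> as soon as it vanishes at all other cells
  feeding \<open>p\<close>: what remains is the diagonal entry times \<open>v $ p\<close>. Induction
  along the network replaces an explicit triangular ordering of the cells.\<close>

lemma inj_cell_map:
  assumes d: "\<And>p. maximal_cell sig p \<Longrightarrow> d p \<noteq> 0"
  shows "inj (cell_map d)"
  unfolding linear_injective_0[OF linear_cell_map]
proof (intro allI impI)
  fix v assume v: "cell_map d v = 0"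
  have "v $ p = 0" for p
    using ff
  proof (induction p rule: feedforward_induct)
    case (step p)
    have *: "cell_map d v $ p = 0" using v by simp
    show ?case
    proof (cases "maximal_cell sig p")
      case True
      then show ?thesis using * d[OF True] by (simp add: cell_map_def)
    next
      case False
      have "(\<Sum>t\<in>- Lset sig p. coef_a f t * v $ sig t p) = 0"
        using step by (intro sum.neutral) (auto simp: Lset_def)
      then have "(\<Sum>s\<in>Lset sig p. coef_a f s) * v $ p = 0"
        using * False sum_coef_a_split[of "\<lambda>p. v $ p" p] by (simp add: cell_map_def)
      then show ?thesis
        using noncrit[OF False] by (simp add: critical_def)
    qed
  qed
  then show "v = 0" by (simp add: vec_eq_iff)
qed

text \<open>Existence is obtained from uniqueness: an injective endomorphism of a finite-dimensional
  space is onto, and the required vector is the preimage under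
  \<open>cell_map (\<lambda>_. 1)\<close> of the data \<open>b\<close> on maximal cells and 0
  elsewhere.\<close>

lemma Dcoeffs_extend:
  assumes "\<And>p. maximal_cell sig p \<Longrightarrow> b p = c \<or> b p = - c"
  shows "\<exists>D\<in>Dcoeffs sig f c. \<forall>p. maximal_cell sig p \<longrightarrow> D p = b p"
proof -
  have "surj (cell_map (\<lambda>_. 1))"
    by (intro linear_inj_imp_surj linear_cell_map inj_cell_map) simp
  then obtain v where v: "cell_map (\<lambda>_. 1) v = (\<chi> p. if maximal_cell sig p then b p else 0)"
    by (metis surjD)
  have *: "cell_map (\<lambda>_. 1) v $ p = (if maximal_cell sig p then b p else 0)" for p
    by (simp add: v)
  have 1: "v $ p = b p" if "maximal_cell sig p" for p
    using *[of p] that by (simp add: cell_map_def)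
  have 2: "(\<Sum>s\<in>UNIV. coef_a f s * v $ sig s p) = 0" if "\<not> maximal_cell sig p" for p
    using *[of p] that by (simp add: cell_map_def)
  show ?thesis
    using assms 1 2 by (intro bexI[of _ "\<lambda>p. v $ p"]) (auto simp: Dcoeffs_iff)
qed

lemma Dcoeffs_eqI:
  assumes "D \<in> Dcoeffs sig f c" "D' \<in> Dcoeffs sig f c"
    and "\<And>p. maximal_cell sig p \<Longrightarrow> D p = D' p"
  shows "D = D'"
proof -
  have "cell_map (\<lambda>_. 1) (\<chi> p. D p) = cell_map (\<lambda>_. 1) (\<chi> p. D' p)"
    using assms by (auto simp: cell_map_def vec_eq_iff Dcoeffs_iff)
  then have "(\<chi> p. D p) = (\<chi> p. D' p)"
    using inj_cell_map[of "\<lambda>_. 1"] by (simp add: inj_eq)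
  then show ?thesis by (auto simp: vec_eq_iff)
qed

lemma card_Dcoeffs: "card (Dcoeffs sig f c) = 2 ^ card {p. maximal_cell sig p}"
proof -
  let ?M = "{p. maximal_cell sig p}"
  have "bij_betw (\<lambda>D. restrict D ?M) (Dcoeffs sig f c) (PiE ?M (\<lambda>_. {c, - c}))"
    unfolding bij_betw_def
  proof (intro conjI)
    show "inj_on (\<lambda>D. restrict D ?M) (Dcoeffs sig f c)"
      by (intro inj_onI Dcoeffs_eqI) (assumption+, metis mem_Collect_eq restrict_apply')
    show "(\<lambda>D. restrict D ?M) ` Dcoeffs sig f c = PiE ?M (\<lambda>_. {c, - c})"
    proof (intro equalityI subsetI)
      fix b assume "b \<in> (\<lambda>D. restrict D ?M) ` Dcoeffs sig f c"
      then obtain D where "D \<in> Dcoeffs sig f c" "b = restrict D ?M" by blast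
      then show "b \<in> PiE ?M (\<lambda>_. {c, - c})" by (simp add: Dcoeffs_iff restrict_PiE_iff)
    next
      fix b assume b: "b \<in> PiE ?M (\<lambda>_. {c, - c})"
      then obtain D where D: "D \<in> Dcoeffs sig f c" "\<forall>p. maximal_cell sig p \<longrightarrow> D p = b p"
        using Dcoeffs_extend[of b] by blast
      then have "b = restrict D ?M"
        using b by (auto simp: fun_eq_iff restrict_def PiE_def extensional_def)
      then show "b \<in> (\<lambda>D. restrict D ?M) ` Dcoeffs sig f c"
        using D by blast
    qed
  qed
  then have "card (Dcoeffs sig f c) = card (PiE ?M (\<lambda>_. {c, - c}))"
    by (rule bij_betw_same_card)
  \<comment> \<open>Positivity of \<open>c\<close> makes \<open>c\<close> and \<open>- c\<close> two
    different values.\<close>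
  also have "\<dots> = 2 ^ card ?M"
    using c_pos by (simp add: card_PiE card_insert_if numeral_2_eq_2)
  finally show ?thesis .
qed

section \<open>Taylor estimates for the cell equations\<close>

lemma gamma_maximal:
  "maximal_cell sig p \<Longrightarrow> gamma sig f x lam $ p = f ((x $ p) *\<^sub>R 1, lam)"
  by (simp add: gamma_def maximal_cell_def) (simp add: scaleR_vec_def one_vec_def)

lemma gamma_input: "gamma sig f x lam $ p = f (input p x, lam)"
  by (simp add: gamma_def input_def)

lemma norm_input: "norm (input p x) \<le> CARD('s) * norm x"
proof -
  have "norm (input p x) \<le> (\<Sum>s\<in>UNIV. \<bar>input p x $ s\<bar>)"
    by (rule norm_le_l1_cart)
  also have "\<dots> \<le> (\<Sum>s\<in>(UNIV::'s set). norm x)"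
    by (intro sum_mono) (simp add: input_def component_le_norm_cart)
  finally show ?thesis by simp
qed

lemma linear_estimate:
  "\<exists>K>0. \<exists>\<delta>>0. \<forall>v lam. norm v \<le> \<delta> \<longrightarrow> \<bar>lam\<bar> \<le> \<delta> \<longrightarrow>
    \<bar>f (v, lam) - (\<Sum>s\<in>UNIV. coef_a f s * v $ s) - coef_l f * lam\<bar> \<le> K * ((norm v)\<^sup>2 + lam\<^sup>2)"
proof -
  obtain K \<delta> where K: "K > 0" "\<delta> > 0" "\<And>\<rho> z z'. \<rho> \<le> \<delta> \<Longrightarrow> norm z \<le> \<rho> \<Longrightarrow> norm z' \<le> \<rho> \<Longrightarrow>
      \<bar>f z - f z' - frechet_derivative f (at 0) (z - z')\<bar> \<le> K * \<rho> * norm (z - z')"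
    using smooth_fun_linearization_Lipschitz[OF smooth] by blast
  have "\<bar>f (v, lam) - (\<Sum>s\<in>UNIV. coef_a f s * v $ s) - coef_l f * lam\<bar> \<le> K * ((norm v)\<^sup>2 + lam\<^sup>2)"
    if "norm v \<le> \<delta> / 2" "\<bar>lam\<bar> \<le> \<delta> / 2" for v lam
  proof -
    have "norm (v, lam) \<le> \<delta>"
      using norm_Pair_le[of v lam] that by simp
    then have "\<bar>f (v, lam) - frechet_derivative f (at 0) (v, lam)\<bar> \<le> K * norm (v, lam) * norm (v, lam)"
      using K(3)[of "norm (v, lam)" "(v, lam)" 0] f00 by (simp add: zero_prod_def)
    also have "\<dots> = K * ((norm v)\<^sup>2 + lam\<^sup>2)"
      by (simp add: norm_Pair mult.assoc flip: power2_eq_square)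
    finally show ?thesis
      by (simp add: frechet_derivative_eq_coefs[OF smooth] diff_diff_eq)
  qed
  then show ?thesis
    using K(1,2) by (intro exI[of _ K] conjI exI[of _ "\<delta> / 2"]) auto
qed

text \<open>With \<open>lam = sg * \<mu>\<^sup>2\<close> the parameter term is itself of second
  order and joins the remainder, leaving only the network-linear part. This is the right precision
  for non-maximal cells, whose equation is divided by a single \<mu>.\<close>

lemma input_estimate:
  "\<exists>K>0. \<exists>\<delta>>0. \<forall>p x \<mu>. norm x \<le> \<delta> \<longrightarrow> 0 < \<mu> \<longrightarrow> \<mu> \<le> \<delta> \<longrightarrow>
    \<bar>gamma sig f x (sg * \<mu>\<^sup>2) $ p - (\<Sum>s\<in>UNIV. coef_a f s * x $ sig s p)\<bar> \<le> K * ((norm x)\<^sup>2 + \<mu>\<^sup>2)"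
proof -
  obtain K \<delta> where K: "K > 0" "\<delta> > 0" "\<And>v lam. norm v \<le> \<delta> \<Longrightarrow> \<bar>lam\<bar> \<le> \<delta> \<Longrightarrow>
    \<bar>f (v, lam) - (\<Sum>s\<in>UNIV. coef_a f s * v $ s) - coef_l f * lam\<bar> \<le> K * ((norm v)\<^sup>2 + lam\<^sup>2)"
    using linear_estimate by blast
  define n where "n = real CARD('s)"
  have n: "n \<ge> 1" by (simp add: n_def Suc_leI)
  \<comment> \<open>Since a cell may feed several arguments, the input vector can be longer than
    \<open>x\<close>, by at most the factor \<open>n\<close>; this is the origin of
    \<open>\<delta> / n\<close>. The bound 1 gives \<open>\<mu>\<^sup>2 \<le> \<mu>\<close>.\<close>
  define \<delta>' where "\<delta>' = min 1 (\<delta> / n)"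
  have \<delta>': "\<delta>' > 0" "\<delta>' \<le> 1" "\<delta>' \<le> \<delta> / n"
    using K n by (auto simp: \<delta>'_def)
  have \<delta>'': "n * \<delta>' \<le> \<delta>" "\<delta>' \<le> \<delta>"
  proof -
    show "n * \<delta>' \<le> \<delta>" using \<delta>' n by (simp add: field_simps)
    then show "\<delta>' \<le> \<delta>" using mult_right_mono[OF n less_imp_le[OF \<delta>'(1)]] by simp
  qed
  define C where "C = K * (n\<^sup>2 + 1) + \<bar>coef_l f\<bar>"
  have "\<bar>gamma sig f x (sg * \<mu>\<^sup>2) $ p - (\<Sum>s\<in>UNIV. coef_a f s * x $ sig s p)\<bar> \<le> C * ((norm x)\<^sup>2 + \<mu>\<^sup>2)"
    if *: "norm x \<le> \<delta>'" "0 < \<mu>" "\<mu> \<le> \<delta>'" for x \<mu> p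
  proof -
    have \<mu>: "\<mu>\<^sup>2 \<le> \<mu>" "\<mu>\<^sup>2 \<le> 1"
      using * \<delta>' by (auto simp: power2_eq_square mult_le_one intro: mult_left_le)
    have abs: "\<bar>sg * \<mu>\<^sup>2\<bar> = \<mu>\<^sup>2" using sg by (simp add: abs_mult)
    have 1: "norm (input p x) \<le> n * norm x" using norm_input by (simp add: n_def)
    have "\<dots> \<le> n * \<delta>'" using * n by (intro mult_left_mono) auto
    then have "norm (input p x) \<le> \<delta>" using 1 \<delta>'' by simp
    moreover have "\<bar>sg * \<mu>\<^sup>2\<bar> \<le> \<delta>" using abs \<mu> * \<delta>'' by simp
    ultimately have 2: "\<bar>f (input p x, sg * \<mu>\<^sup>2) - (\<Sum>s\<in>UNIV. coef_a f s * x $ sig s p) - coef_l f * (sg * \<mu>\<^sup>2)\<bar>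
        \<le> K * ((norm (input p x))\<^sup>2 + (sg * \<mu>\<^sup>2)\<^sup>2)"
      using K(3)[of "input p x" "sg * \<mu>\<^sup>2"] by (simp add: input_def)
    have "(norm (input p x))\<^sup>2 \<le> n\<^sup>2 * (norm x)\<^sup>2"
      using power_mono[OF 1, of 2] by (simp add: power_mult_distrib)
    moreover have "(sg * \<mu>\<^sup>2)\<^sup>2 \<le> \<mu>\<^sup>2"
    proof -
      have "(sg * \<mu>\<^sup>2)\<^sup>2 = \<mu>\<^sup>2 * \<mu>\<^sup>2"
        using abs by (metis power2_abs power2_eq_square)
      also have "\<dots> \<le> \<mu>\<^sup>2" using \<mu> by (intro mult_left_le) auto
      finally show ?thesis .
    qed
    ultimately have "(norm (input p x))\<^sup>2 + (sg * \<mu>\<^sup>2)\<^sup>2 \<le> (n\<^sup>2 + 1) * ((norm x)\<^sup>2 + \<mu>\<^sup>2)"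
      using zero_le_power2[of "norm x"] mult_nonneg_nonneg[OF zero_le_power2[of n] zero_le_power2[of \<mu>]]
      unfolding distrib_left distrib_right by linarith
    then have 3: "K * ((norm (input p x))\<^sup>2 + (sg * \<mu>\<^sup>2)\<^sup>2) \<le> K * (n\<^sup>2 + 1) * ((norm x)\<^sup>2 + \<mu>\<^sup>2)"
      using K(1) by (simp add: mult.assoc)
    have "\<bar>coef_l f * (sg * \<mu>\<^sup>2)\<bar> \<le> \<bar>coef_l f\<bar> * ((norm x)\<^sup>2 + \<mu>\<^sup>2)"
      unfolding abs_mult[of "coef_l f"] abs by (intro mult_left_mono) auto
    then show ?thesis
      using 2 3 unfolding C_def gamma_input distrib_right[of _ "\<bar>coef_l f\<bar>"] by linarith
  qed
  moreover have "C > 0"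
    unfolding C_def using K(1) by (intro add_pos_nonneg mult_pos_pos add_nonneg_pos) auto
  ultimately show ?thesis
    using \<delta>'(1) by blast
qed

text \<open>The linear term in \<open>lam\<close> cancels in the difference, so only the size of
  \<open>lam\<close> matters. The Lipschitz constant of order \<rho> is what makes the nonlinear
  part of a non-maximal equation a small perturbation after rescaling.\<close>

lemma input_difference_estimate:
  "\<exists>K>0. \<exists>\<delta>>0. \<forall>p \<rho> x x' lam. \<rho> \<le> \<delta> \<longrightarrow> norm x \<le> \<rho> \<longrightarrow> norm x' \<le> \<rho> \<longrightarrow> \<bar>lam\<bar> \<le> \<rho> \<longrightarrow>
    \<bar>gamma sig f x lam $ p - gamma sig f x' lam $ p - (\<Sum>s\<in>UNIV. coef_a f s * (x - x') $ sig s p)\<bar>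
      \<le> K * \<rho> * norm (x - x')"
proof -
  obtain K \<delta> where K: "K > 0" "\<delta> > 0" "\<And>\<rho> z z'. \<rho> \<le> \<delta> \<Longrightarrow> norm z \<le> \<rho> \<Longrightarrow> norm z' \<le> \<rho> \<Longrightarrow>
      \<bar>f z - f z' - frechet_derivative f (at 0) (z - z')\<bar> \<le> K * \<rho> * norm (z - z')"
    using smooth_fun_linearization_Lipschitz[OF smooth] by blast
  define n where "n = real CARD('s)"
  have n: "n > 0" by (simp add: n_def)
  \<comment> \<open>The factor \<open>n + 1\<close> bounds the norm of the pair of input and
    parameter in terms of \<rho>, the factor \<open>n\<close> the input belonging to
    \<open>x - x'\<close>.\<close>
  have "\<bar>gamma sig f x lam $ p - gamma sig f x' lam $ p - (\<Sum>s\<in>UNIV. coef_a f s * (x - x') $ sig s p)\<bar>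
      \<le> K * (n + 1) * n * \<rho> * norm (x - x')"
    if *: "\<rho> \<le> \<delta> / (n + 1)" "norm x \<le> \<rho>" "norm x' \<le> \<rho>" "\<bar>lam\<bar> \<le> \<rho>" for \<rho> x x' lam p
  proof -
    have bound: "norm (input p y, lam) \<le> (n + 1) * \<rho>" if "norm y \<le> \<rho>" for y
    proof -
      have "norm (input p y, lam) \<le> n * norm y + \<bar>lam\<bar>"
        using norm_Pair_le[of "input p y" lam] norm_input[of p y] by (simp add: n_def)
      also have "\<dots> \<le> n * \<rho> + \<rho>"
        using that * n by (intro add_mono mult_left_mono) auto
      finally show ?thesis by (simp add: algebra_simps)
    qed
    have diff: "(input p x, lam) - (input p x', lam) = (input p (x - x'), 0)"
      by (simp add: input_def vec_eq_iff)
    have "(n + 1) * \<rho> \<le> \<delta>" using * n by (simp add: field_simps)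
    then have "\<bar>f (input p x, lam) - f (input p x', lam) - frechet_derivative f (at 0) (input p (x - x'), 0)\<bar>
        \<le> K * ((n + 1) * \<rho>) * norm (input p (x - x'))"
      using K(3)[of "(n + 1) * \<rho>" "(input p x, lam)" "(input p x', lam)"] bound * unfolding diff
      by (simp add: norm_Pair)
    also have "\<dots> \<le> K * ((n + 1) * \<rho>) * (n * norm (x - x'))"
      using norm_input[of p "x - x'"] K(1) n * order_trans[OF norm_ge_zero *(2)]
      by (intro mult_left_mono) (auto simp: n_def)
    finally show ?thesis
      unfolding gamma_input frechet_derivative_eq_coefs[OF smooth] by (simp add: input_def mult_ac)
  qed
  then show ?thesis
    using K(1,2) n by (intro exI[of _ "K * (n + 1) * n"] conjI exI[of _ "\<delta> / (n + 1)"]) auto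
qed

text \<open>The value at \<open>(0, lam)\<close> is given by the linear estimate, with
  \<open>coef_l f * sg = - Q * c\<^sup>2\<close> and an error of order
  \<open>lam\<^sup>2 = \<mu> ^ 4\<close>; the increment from 0 to \<open>y\<close> is given by the
  diagonal estimate. For \<open>y\<close> of order \<mu> the total error is of order
  \<open>\<mu> ^ 3\<close>, one order below the main term.\<close>

lemma maximal_estimate:
  "\<exists>K>0. \<exists>\<delta>>0. \<forall>y \<mu>. \<bar>y\<bar> \<le> \<delta> \<longrightarrow> 0 < \<mu> \<longrightarrow> \<mu> \<le> \<delta> \<longrightarrow>
    \<bar>f (y *\<^sub>R 1, sg * \<mu>\<^sup>2) - Q * (y\<^sup>2 - c\<^sup>2 * \<mu>\<^sup>2)\<bar> \<le> K * ((y\<^sup>2 + \<mu>\<^sup>2) * \<bar>y\<bar> + \<mu> ^ 4)"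
proof -
  obtain K1 \<delta>1 where K1: "K1 > 0" "\<delta>1 > 0" "\<And>v lam. norm v \<le> \<delta>1 \<Longrightarrow> \<bar>lam\<bar> \<le> \<delta>1 \<Longrightarrow>
    \<bar>f (v, lam) - (\<Sum>s\<in>UNIV. coef_a f s * v $ s) - coef_l f * lam\<bar> \<le> K1 * ((norm v)\<^sup>2 + lam\<^sup>2)"
    using linear_estimate by blast
  obtain K2 \<delta>2 where K2: "K2 > 0" "\<delta>2 > 0"
    "\<And>\<rho> lam y y'. \<rho> \<le> \<delta>2 \<Longrightarrow> \<bar>lam\<bar> \<le> \<delta>2 \<Longrightarrow> \<bar>y\<bar> \<le> \<rho> \<Longrightarrow> \<bar>y'\<bar> \<le> \<rho> \<Longrightarrow>
    \<bar>f (y *\<^sub>R 1, lam) - f (y' *\<^sub>R 1, lam) - Q * (y\<^sup>2 - y'\<^sup>2)\<bar> \<le> K2 * (\<rho>\<^sup>2 + \<bar>lam\<bar>) * \<bar>y - y'\<bar>"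
    using diagonal_quadratic_estimate[OF smooth sum_coef_a] unfolding Q_def by blast
  define \<delta> where "\<delta> = min 1 (min \<delta>1 \<delta>2)"
  have \<delta>: "\<delta> > 0" "\<delta> \<le> 1" "\<delta> \<le> \<delta>1" "\<delta> \<le> \<delta>2"
    using K1 K2 by (auto simp: \<delta>_def)
  have "\<bar>f (y *\<^sub>R 1, sg * \<mu>\<^sup>2) - Q * (y\<^sup>2 - c\<^sup>2 * \<mu>\<^sup>2)\<bar> \<le> (K1 + K2) * ((y\<^sup>2 + \<mu>\<^sup>2) * \<bar>y\<bar> + \<mu> ^ 4)"
    if *: "\<bar>y\<bar> \<le> \<delta>" "0 < \<mu>" "\<mu> \<le> \<delta>" for y \<mu>
  proof -
    have "\<mu>\<^sup>2 \<le> \<mu>"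
      using * \<delta> by (auto simp: power2_eq_square intro: mult_left_le)
    moreover have abs: "\<bar>sg * \<mu>\<^sup>2\<bar> = \<mu>\<^sup>2" using sg by (simp add: abs_mult)
    ultimately have lam: "\<bar>sg * \<mu>\<^sup>2\<bar> \<le> \<delta>" using * by simp
    have "\<bar>f (0, sg * \<mu>\<^sup>2) - coef_l f * (sg * \<mu>\<^sup>2)\<bar> \<le> K1 * (sg * \<mu>\<^sup>2)\<^sup>2"
      using K1(3)[of 0 "sg * \<mu>\<^sup>2"] lam \<delta> K1(2) by simp
    also have "(sg * \<mu>\<^sup>2)\<^sup>2 = \<mu> ^ 4"
      using abs by (metis power2_abs power_mult mult_2 numeral_Bit0)
    also have "coef_l f * (sg * \<mu>\<^sup>2) = - ((Q * c\<^sup>2) * \<mu>\<^sup>2)"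
      unfolding Q_c_squared by simp
    finally have 1: "\<bar>f (0, sg * \<mu>\<^sup>2) + Q * (c\<^sup>2 * \<mu>\<^sup>2)\<bar> \<le> K1 * \<mu> ^ 4"
      by (simp add: mult.assoc)
    have 2: "\<bar>f (y *\<^sub>R 1, sg * \<mu>\<^sup>2) - f (0, sg * \<mu>\<^sup>2) - Q * y\<^sup>2\<bar> \<le> K2 * ((y\<^sup>2 + \<mu>\<^sup>2) * \<bar>y\<bar>)"
      using K2(3)[of "\<bar>y\<bar>" "sg * \<mu>\<^sup>2" y 0] lam \<delta> * abs by (simp add: mult.assoc)
    have "0 \<le> K1 * ((y\<^sup>2 + \<mu>\<^sup>2) * \<bar>y\<bar>)" "0 \<le> K2 * \<mu> ^ 4"
      using K1(1) K2(1) by auto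
    then show ?thesis
      using 1 2 unfolding distrib_left distrib_right right_diff_distrib by linarith
  qed
  then show ?thesis
    using K1(1) K2(1) \<delta>(1) by (intro exI[of _ "K1 + K2"] conjI exI[of _ \<delta>]) auto
qed

section \<open>A priori estimates\<close>

text \<open>The estimate is used twice. For small \<open>r\<close> it yields the crude bound
  \<open>\<bar>y\<bar> \<le> C * \<mu>\<close>; inserted back, this gives
  \<open>y\<^sup>2 - c\<^sup>2 * \<mu>\<^sup>2\<close> up to order \<open>\<mu> ^ 3\<close>. One of
  the factors \<open>y - c * \<mu>\<close> and \<open>y + c * \<mu>\<close> has modulus at least
  \<open>c * \<mu>\<close>, so the other one is of order \<open>\<mu>\<^sup>2\<close>.\<close>

lemma maximal_roots:
  "\<exists>r>0. \<exists>\<epsilon>>0. \<exists>K>0. \<forall>y \<mu>. 0 < \<mu> \<longrightarrow> \<mu> < \<epsilon> \<longrightarrow> \<bar>y\<bar> < r \<longrightarrow> f (y *\<^sub>R 1, sg * \<mu>\<^sup>2) = 0 \<longrightarrow>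
    \<bar>y - c * \<mu>\<bar> \<le> K * \<mu>\<^sup>2 \<or> \<bar>y + c * \<mu>\<bar> \<le> K * \<mu>\<^sup>2"
proof -
  obtain K \<delta> where K: "K > 0" "\<delta> > 0" "\<And>y \<mu>. \<bar>y\<bar> \<le> \<delta> \<Longrightarrow> 0 < \<mu> \<Longrightarrow> \<mu> \<le> \<delta> \<Longrightarrow>
    \<bar>f (y *\<^sub>R 1, sg * \<mu>\<^sup>2) - Q * (y\<^sup>2 - c\<^sup>2 * \<mu>\<^sup>2)\<bar> \<le> K * ((y\<^sup>2 + \<mu>\<^sup>2) * \<bar>y\<bar> + \<mu> ^ 4)"
    using maximal_estimate by blast
  define \<kappa> where "\<kappa> = K / \<bar>Q\<bar>"
  have \<kappa>: "\<kappa> > 0" using K Q_nonzero by (simp add: \<kappa>_def)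
  \<comment> \<open>Chosen so that \<open>\<kappa> * \<bar>y\<bar> \<le> 1 / 2\<close>: the cubic
    error then costs at most half of \<open>y\<^sup>2 + \<mu>\<^sup>2\<close>.\<close>
  define r where "r = min \<delta> (1 / (2 * \<kappa>))"
  define \<epsilon> where "\<epsilon> = min \<delta> 1"
  have r: "r > 0" "r \<le> \<delta>" "\<kappa> * r \<le> 1 / 2"
  proof -
    show "r > 0" "r \<le> \<delta>" using K \<kappa> by (auto simp: r_def)
    have "r \<le> 1 / (2 * \<kappa>)" by (simp add: r_def)
    then show "\<kappa> * r \<le> 1 / 2" using \<kappa> by (simp add: field_simps)
  qed
  have \<epsilon>: "\<epsilon> > 0" "\<epsilon> \<le> \<delta>" "\<epsilon> \<le> 1" using K by (auto simp: \<epsilon>_def)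
  \<comment> \<open>Obtained by solving \<open>y\<^sup>2 - c\<^sup>2 * \<mu>\<^sup>2 \<le> 1 / 2 *
    (y\<^sup>2 + \<mu>\<^sup>2) + \<kappa> * \<mu>\<^sup>2\<close> for
    \<open>y\<^sup>2\<close>.\<close>
  define C where "C = sqrt (2 * c\<^sup>2 + 1 + 2 * \<kappa>)"
  have C: "C > 0" "C\<^sup>2 = 2 * c\<^sup>2 + 1 + 2 * \<kappa>"
    using \<kappa> by (auto simp: C_def add_nonneg_pos)
  define L where "L = \<kappa> * ((C\<^sup>2 + 1) * C + 1)"
  have L: "L > 0" unfolding L_def using \<kappa> C(1) by (intro mult_pos_pos add_pos_pos) (auto simp: add_nonneg_pos)
  have "\<bar>y - c * \<mu>\<bar> \<le> L / c * \<mu>\<^sup>2 \<or> \<bar>y + c * \<mu>\<bar> \<le> L / c * \<mu>\<^sup>2"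
    if *: "0 < \<mu>" "\<mu> < \<epsilon>" "\<bar>y\<bar> < r" "f (y *\<^sub>R 1, sg * \<mu>\<^sup>2) = 0" for y \<mu>
  proof -
    have "\<bar>Q\<bar> * \<bar>y\<^sup>2 - c\<^sup>2 * \<mu>\<^sup>2\<bar> \<le> K * ((y\<^sup>2 + \<mu>\<^sup>2) * \<bar>y\<bar> + \<mu> ^ 4)"
      using K(3)[of y \<mu>] * r \<epsilon> by (simp add: abs_mult)
    then have 1: "\<bar>y\<^sup>2 - c\<^sup>2 * \<mu>\<^sup>2\<bar> \<le> \<kappa> * ((y\<^sup>2 + \<mu>\<^sup>2) * \<bar>y\<bar> + \<mu> ^ 4)"
      using Q_nonzero by (simp add: \<kappa>_def field_simps)
    have \<mu>3: "\<mu> ^ 4 \<le> \<mu> ^ 3" "\<mu> ^ 4 \<le> \<mu>\<^sup>2"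
      using * \<epsilon> by (auto intro!: power_decreasing)
    have "\<kappa> * ((y\<^sup>2 + \<mu>\<^sup>2) * \<bar>y\<bar>) \<le> 1 / 2 * (y\<^sup>2 + \<mu>\<^sup>2)"
    proof -
      have "\<kappa> * \<bar>y\<bar> \<le> \<kappa> * r" using * \<kappa> by (intro mult_left_mono) auto
      then have "(\<kappa> * \<bar>y\<bar>) * (y\<^sup>2 + \<mu>\<^sup>2) \<le> 1 / 2 * (y\<^sup>2 + \<mu>\<^sup>2)"
        using r by (intro mult_right_mono) auto
      then show ?thesis by (simp add: mult_ac)
    qed
    moreover have "\<kappa> * \<mu> ^ 4 \<le> \<kappa> * \<mu>\<^sup>2" using \<mu>3 \<kappa> by simp
    ultimately have "y\<^sup>2 \<le> C\<^sup>2 * \<mu>\<^sup>2"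
      using 1 unfolding C(2) distrib_left distrib_right by linarith
    then have "y\<^sup>2 \<le> (C * \<mu>)\<^sup>2" by (simp add: power_mult_distrib)
    then have y: "\<bar>y\<bar> \<le> C * \<mu>"
      using C(1) * by (simp add: abs_le_square_iff[symmetric] abs_mult)
    have "(y\<^sup>2 + \<mu>\<^sup>2) * \<bar>y\<bar> \<le> (C\<^sup>2 * \<mu>\<^sup>2 + \<mu>\<^sup>2) * (C * \<mu>)"
      using \<open>y\<^sup>2 \<le> C\<^sup>2 * \<mu>\<^sup>2\<close> y by (intro mult_mono) auto
    also have "\<dots> = (C\<^sup>2 + 1) * C * \<mu> ^ 3"
      by (simp add: power2_eq_square power3_eq_cube algebra_simps)
    finally have "(y\<^sup>2 + \<mu>\<^sup>2) * \<bar>y\<bar> + \<mu> ^ 4 \<le> ((C\<^sup>2 + 1) * C + 1) * \<mu> ^ 3"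
      using \<mu>3 by (simp add: distrib_right)
    then have "\<kappa> * ((y\<^sup>2 + \<mu>\<^sup>2) * \<bar>y\<bar> + \<mu> ^ 4) \<le> L * \<mu> ^ 3"
      unfolding L_def mult.assoc[of \<kappa>] using \<kappa> by (intro mult_left_mono) auto
    then have "\<bar>y\<^sup>2 - c\<^sup>2 * \<mu>\<^sup>2\<bar> \<le> L * \<mu> ^ 3"
      using 1 by linarith
    moreover have "y\<^sup>2 - c\<^sup>2 * \<mu>\<^sup>2 = (y - c * \<mu>) * (y + c * \<mu>)"
      by (simp add: power2_eq_square algebra_simps)
    ultimately have prod: "\<bar>y - c * \<mu>\<bar> * \<bar>y + c * \<mu>\<bar> \<le> L * \<mu> ^ 3"
      by (simp add: abs_mult)
    have conclude: "u \<le> L / c * \<mu>\<^sup>2" if "u * v \<le> L * \<mu> ^ 3" "c * \<mu> \<le> v" "u \<ge> 0" for u v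
    proof -
      have "u * (c * \<mu>) \<le> L * \<mu> ^ 3"
        using that mult_left_mono[of "c * \<mu>" v u] by linarith
      then have "(u * c) * \<mu> \<le> (L * \<mu>\<^sup>2) * \<mu>"
        by (simp add: power2_eq_square power3_eq_cube mult_ac)
      then show ?thesis
        using *(1) c_pos by (simp add: field_simps)
    qed
    show ?thesis
    proof (cases "y \<ge> 0")
      case True
      then show ?thesis using conclude[OF prod] by simp
    next
      case False
      then show ?thesis
        using conclude[of "\<bar>y + c * \<mu>\<bar>" "\<bar>y - c * \<mu>\<bar>"] prod by (simp add: mult.commute)
    qed
  qed
  then show ?thesis
    using r(1) \<epsilon>(1) L c_pos by (intro exI[of _ r] conjI exI[of _ \<epsilon>] exI[of _ "L / c"]) auto
qed

text \<open>The root near which each maximal cell lies fixes the signs, hence \<open>D\<close>. The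
  deviation \<open>v = x - \<mu> *\<^sub>R d\<close> is measured through the injective map
  \<open>cell_map (\<lambda>_. 1)\<close>, which is bounded below: at maximal cells its value is
  small by the choice of signs, and elsewhere the contribution of \<open>D\<close> cancels, so the
  steady state equation leaves only a quadratic remainder.\<close>

lemma small_steady_state_near_Dcoeffs:
  "\<exists>r>0. \<exists>\<epsilon>>0. \<exists>K>0. \<forall>x \<mu>. 0 < \<mu> \<longrightarrow> \<mu> < \<epsilon> \<longrightarrow> norm x < r \<longrightarrow> gamma sig f x (sg * \<mu>\<^sup>2) = 0 \<longrightarrow>
    (\<exists>D\<in>Dcoeffs sig f c. norm (x - \<mu> *\<^sub>R (\<chi> p. D p)) \<le> K * \<mu>\<^sup>2)"
proof -
  obtain r1 \<epsilon>1 K1 where K1: "r1 > 0" "\<epsilon>1 > 0" "K1 > 0"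
    "\<And>y \<mu>. 0 < \<mu> \<Longrightarrow> \<mu> < \<epsilon>1 \<Longrightarrow> \<bar>y\<bar> < r1 \<Longrightarrow> f (y *\<^sub>R 1, sg * \<mu>\<^sup>2) = 0 \<Longrightarrow>
      \<bar>y - c * \<mu>\<bar> \<le> K1 * \<mu>\<^sup>2 \<or> \<bar>y + c * \<mu>\<bar> \<le> K1 * \<mu>\<^sup>2"
    using maximal_roots by blast
  obtain K2 \<delta> where K2: "K2 > 0" "\<delta> > 0" "\<And>p x \<mu>. norm x \<le> \<delta> \<Longrightarrow> 0 < \<mu> \<Longrightarrow> \<mu> \<le> \<delta> \<Longrightarrow>
    \<bar>gamma sig f x (sg * \<mu>\<^sup>2) $ p - (\<Sum>s\<in>UNIV. coef_a f s * x $ sig s p)\<bar> \<le> K2 * ((norm x)\<^sup>2 + \<mu>\<^sup>2)"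
    using input_estimate by blast
  let ?N = "cell_map (\<lambda>_. 1)"
  obtain b where b: "b > 0" "\<And>v. b * norm v \<le> norm (?N v)"
    using linear_inj_bounded_below_pos[OF linear_cell_map inj_cell_map, of "\<lambda>_. 1"] by auto
  define n where "n = real CARD('c)"
  have n: "n > 0" by (simp add: n_def)
  \<comment> \<open>\<open>E\<close> is the constant in
    \<open>norm v \<le> E * ((norm x)\<^sup>2 + \<mu>\<^sup>2)\<close>, and \<open>F\<close> below
    bounds the norm of every coefficient vector. The choice of \<open>r\<close> gives
    \<open>E * (norm x)\<^sup>2 \<le> 1 / 2 * norm x\<close>, so this term can be absorbed.\<close>
  define E where "E = n * (K1 + K2) / b"
  have E: "E > 0" using K1 K2 b n by (simp add: E_def)
  define F where "F = n * c / b"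
  have F: "F > 0" using c_pos b n by (simp add: F_def)
  define r where "r = min (min r1 \<delta>) (1 / (2 * E))"
  define \<epsilon> where "\<epsilon> = min (min \<epsilon>1 \<delta>) 1"
  have r: "r > 0" "r \<le> r1" "r \<le> \<delta>" "E * r \<le> 1 / 2"
  proof -
    show "r > 0" "r \<le> r1" "r \<le> \<delta>" using K1 K2 E by (auto simp: r_def)
    have "r \<le> 1 / (2 * E)" by (simp add: r_def)
    then show "E * r \<le> 1 / 2" using E by (simp add: field_simps)
  qed
  have \<epsilon>: "\<epsilon> > 0" "\<epsilon> \<le> \<epsilon>1" "\<epsilon> \<le> \<delta>" "\<epsilon> \<le> 1" using K1 K2 by (auto simp: \<epsilon>_def)
  \<comment> \<open>Absorption gives \<open>norm x \<le> (2 * E + 2 * F) * \<mu>\<close>; inserting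
    this into the bound for \<open>v\<close> produces the constant.\<close>
  have "\<exists>D\<in>Dcoeffs sig f c. norm (x - \<mu> *\<^sub>R (\<chi> p. D p)) \<le> E * ((2 * E + 2 * F)\<^sup>2 + 1) * \<mu>\<^sup>2"
    if *: "0 < \<mu>" "\<mu> < \<epsilon>" "norm x < r" "gamma sig f x (sg * \<mu>\<^sup>2) = 0" for x \<mu>
  proof -
    have "\<exists>y. (y = c \<or> y = - c) \<and> \<bar>x $ p - y * \<mu>\<bar> \<le> K1 * \<mu>\<^sup>2" if "maximal_cell sig p" for p
    proof -
      have "\<bar>x $ p\<bar> < r1" using component_le_norm_cart[of x p] * r by simp
      moreover have "f ((x $ p) *\<^sub>R 1, sg * \<mu>\<^sup>2) = 0"
        using gamma_maximal[OF that, of x "sg * \<mu>\<^sup>2"] * by simp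
      ultimately show ?thesis
        using K1(4)[of \<mu> "x $ p"] * \<epsilon> by (metis diff_minus_eq_add less_le_trans mult_minus_left)
    qed
    then obtain sgn where sgn: "\<And>p. maximal_cell sig p \<Longrightarrow> sgn p = c \<or> sgn p = - c"
      "\<And>p. maximal_cell sig p \<Longrightarrow> \<bar>x $ p - sgn p * \<mu>\<bar> \<le> K1 * \<mu>\<^sup>2"
      by metis
    obtain D where D: "D \<in> Dcoeffs sig f c" "\<And>p. maximal_cell sig p \<Longrightarrow> D p = sgn p"
      using Dcoeffs_extend[of sgn] sgn(1) by blast
    define d where "d = (\<chi> p. D p)"
    define v where "v = x - \<mu> *\<^sub>R d"
    have "b * norm d \<le> norm (?N d)" by (rule b)
    also have "\<dots> \<le> n * c"
      unfolding n_def
    proof (rule norm_le_card_mult)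
      fix p
      show "\<bar>?N d $ p\<bar> \<le> c"
        using D(1) c_pos unfolding Dcoeffs_iff by (auto simp: cell_map_def d_def)
    qed
    finally have d: "norm d \<le> F" using b by (simp add: F_def field_simps)
    have "b * norm v \<le> norm (?N v)" by (rule b)
    also have "\<dots> \<le> n * ((K1 + K2) * ((norm x)\<^sup>2 + \<mu>\<^sup>2))"
      unfolding n_def
    proof (rule norm_le_card_mult)
      fix p
      have nonneg: "0 \<le> K1 * (norm x)\<^sup>2" "0 \<le> K1 * \<mu>\<^sup>2" "0 \<le> K2 * (norm x)\<^sup>2" "0 \<le> K2 * \<mu>\<^sup>2"
        using K1 K2 by auto
      show "\<bar>?N v $ p\<bar> \<le> (K1 + K2) * ((norm x)\<^sup>2 + \<mu>\<^sup>2)"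
      proof (cases "maximal_cell sig p")
        case True
        then have "\<bar>?N v $ p\<bar> \<le> K1 * \<mu>\<^sup>2"
          using sgn(2)[OF True] D(2)[OF True] by (simp add: cell_map_def v_def d_def mult.commute)
        then show ?thesis using nonneg unfolding distrib_left distrib_right by linarith
      next
        case False
        have "(\<Sum>s\<in>UNIV. coef_a f s * v $ sig s p) =
          (\<Sum>s\<in>UNIV. coef_a f s * x $ sig s p) - \<mu> * (\<Sum>s\<in>UNIV. coef_a f s * D (sig s p))"
          by (simp add: v_def d_def right_diff_distrib sum_subtractf sum_distrib_left mult_ac)
        then have "?N v $ p = (\<Sum>s\<in>UNIV. coef_a f s * x $ sig s p)"
          using False D(1) by (simp add: cell_map_def Dcoeffs_iff)
        moreover have "\<bar>gamma sig f x (sg * \<mu>\<^sup>2) $ p - (\<Sum>s\<in>UNIV. coef_a f s * x $ sig s p)\<bar>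
            \<le> K2 * ((norm x)\<^sup>2 + \<mu>\<^sup>2)"
          using K2(3)[of x \<mu> p] * r \<epsilon> by simp
        ultimately have "\<bar>?N v $ p\<bar> \<le> K2 * ((norm x)\<^sup>2 + \<mu>\<^sup>2)"
          using * by simp
        then show ?thesis using nonneg unfolding distrib_left distrib_right by linarith
      qed
    qed
    finally have v: "norm v \<le> E * ((norm x)\<^sup>2 + \<mu>\<^sup>2)"
      using b by (simp add: E_def field_simps)
    have "norm x \<le> norm v + norm (\<mu> *\<^sub>R d)"
      using norm_triangle_ineq[of v "\<mu> *\<^sub>R d"] by (simp add: v_def)
    also have "norm (\<mu> *\<^sub>R d) \<le> F * \<mu>"
      using d * by (simp add: mult.commute mult_left_mono)
    finally have x: "norm x \<le> norm v + F * \<mu>" by simp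
    have "E * (norm x)\<^sup>2 \<le> 1 / 2 * norm x"
    proof -
      have "E * norm x \<le> E * r" using * E by (intro mult_left_mono) auto
      then have "(E * norm x) * norm x \<le> 1 / 2 * norm x"
        using r by (intro mult_right_mono) auto
      then show ?thesis by (simp add: power2_eq_square mult.assoc)
    qed
    moreover have "E * \<mu>\<^sup>2 \<le> E * \<mu>"
      using * \<epsilon> E by (intro mult_left_mono) (auto simp: power2_eq_square intro: mult_left_le)
    ultimately have "norm v \<le> 2 * (E * \<mu>) + F * \<mu>"
      using v x unfolding distrib_left by linarith
    then have "norm x \<le> (2 * E + 2 * F) * \<mu>"
      using x unfolding distrib_right by linarith
    then have "(norm x)\<^sup>2 \<le> ((2 * E + 2 * F) * \<mu>)\<^sup>2"
      by (intro power_mono) auto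
    then have "(norm x)\<^sup>2 + \<mu>\<^sup>2 \<le> ((2 * E + 2 * F)\<^sup>2 + 1) * \<mu>\<^sup>2"
      by (simp only: power_mult_distrib distrib_right[of _ 1] mult_1 add_le_cancel_right)
    then have "E * ((norm x)\<^sup>2 + \<mu>\<^sup>2) \<le> E * (((2 * E + 2 * F)\<^sup>2 + 1) * \<mu>\<^sup>2)"
      using E by (intro mult_left_mono) auto
    then have "norm v \<le> E * ((2 * E + 2 * F)\<^sup>2 + 1) * \<mu>\<^sup>2"
      using v by (simp add: mult.assoc)
    then show ?thesis
      using D(1) unfolding v_def d_def by blast
  qed
  moreover have "E * ((2 * E + 2 * F)\<^sup>2 + 1) > 0"
    using E by (intro mult_pos_pos add_nonneg_pos) auto
  ultimately show ?thesis
    using r(1) \<epsilon>(1) by (intro exI[of _ r] conjI exI[of _ \<epsilon>]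
        exI[of _ "E * ((2 * E + 2 * F)\<^sup>2 + 1)"]) auto
qed

section \<open>The branches\<close>

text \<open>Meaningful for \<open>\<mu> > 0\<close> only: at 0, division by zero yields the zero
  vector and not the limit system.\<close>

definition rescaled :: "real \<Rightarrow> real^'c \<Rightarrow> real^'c" where
  "rescaled \<mu> w = (\<chi> p. gamma sig f (\<mu> *\<^sub>R w) (sg * \<mu>\<^sup>2) $ p / (if maximal_cell sig p then \<mu>\<^sup>2 else \<mu>))"

lemma rescaled_eq_0_iff:
  "\<mu> > 0 \<Longrightarrow> rescaled \<mu> w = 0 \<longleftrightarrow> gamma sig f (\<mu> *\<^sub>R w) (sg * \<mu>\<^sup>2) = 0"
  by (auto simp: rescaled_def vec_eq_iff)

lemma continuous_on_rescaled: "continuous_on {0<..} (\<lambda>\<mu>. rescaled \<mu> w)"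
proof -
  have f: "continuous_on UNIV f"
    using smooth_fun_has_derivative[OF smooth] has_derivative_continuous
    by (metis continuous_at_imp_continuous_on)
  have "continuous_on {0<..} (\<lambda>\<mu>. f (\<chi> s. \<mu> * w $ sig s p, sg * \<mu>\<^sup>2) / (if maximal_cell sig p then \<mu>\<^sup>2 else \<mu>))" for p
    by (cases "maximal_cell sig p")
      (auto intro!: continuous_intros continuous_on_compose2[OF f] continuous_on_vec_lambda)
  then show ?thesis
    unfolding rescaled_def gamma_def by (simp add: continuous_on_vec_lambda)
qed

text \<open>At \<open>\<mu> *\<^sub>R d\<close> the leading terms of all equations cancel. The
  residual is of order \<open>\<mu> ^ 3\<close> at maximal cells and \<open>\<mu>\<^sup>2\<close> at
  the others, so one power of \<mu> survives the respective division.\<close>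

lemma rescaled_at_Dcoeffs:
  assumes D: "D \<in> Dcoeffs sig f c"
  shows "\<exists>K\<ge>0. \<exists>\<epsilon>>0. \<forall>\<mu>. 0 < \<mu> \<longrightarrow> \<mu> < \<epsilon> \<longrightarrow> norm (rescaled \<mu> (\<chi> p. D p)) \<le> K * \<mu>"
proof -
  obtain K1 \<delta>1 where K1: "K1 > 0" "\<delta>1 > 0" "\<And>p x \<mu>. norm x \<le> \<delta>1 \<Longrightarrow> 0 < \<mu> \<Longrightarrow> \<mu> \<le> \<delta>1 \<Longrightarrow>
    \<bar>gamma sig f x (sg * \<mu>\<^sup>2) $ p - (\<Sum>s\<in>UNIV. coef_a f s * x $ sig s p)\<bar> \<le> K1 * ((norm x)\<^sup>2 + \<mu>\<^sup>2)"
    using input_estimate by blast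
  obtain K2 \<delta>2 where K2: "K2 > 0" "\<delta>2 > 0" "\<And>y \<mu>. \<bar>y\<bar> \<le> \<delta>2 \<Longrightarrow> 0 < \<mu> \<Longrightarrow> \<mu> \<le> \<delta>2 \<Longrightarrow>
    \<bar>f (y *\<^sub>R 1, sg * \<mu>\<^sup>2) - Q * (y\<^sup>2 - c\<^sup>2 * \<mu>\<^sup>2)\<bar> \<le> K2 * ((y\<^sup>2 + \<mu>\<^sup>2) * \<bar>y\<bar> + \<mu> ^ 4)"
    using maximal_estimate by blast
  define d where "d = (\<chi> p. D p)"
  \<comment> \<open>\<open>n\<close> dominates \<open>norm d\<close>, \<open>c\<close> and 1
    simultaneously, so a single condition on \<epsilon> keeps all arguments within the radii of both
    estimates.\<close>
  define n where "n = norm d + c + 1"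
  have n: "n \<ge> 1" "norm d \<le> n" "c \<le> n" using c_pos by (auto simp: n_def)
  define \<epsilon> where "\<epsilon> = min 1 (min \<delta>1 \<delta>2 / n)"
  have \<epsilon>: "\<epsilon> > 0" "\<epsilon> \<le> 1" "\<epsilon> * n \<le> \<delta>1" "\<epsilon> * n \<le> \<delta>2"
  proof -
    show "\<epsilon> > 0" "\<epsilon> \<le> 1" using K1 K2 n by (auto simp: \<epsilon>_def)
    have "\<epsilon> \<le> min \<delta>1 \<delta>2 / n" by (simp add: \<epsilon>_def)
    then have "\<epsilon> * n \<le> min \<delta>1 \<delta>2" using n by (simp add: pos_le_divide_eq)
    then show "\<epsilon> * n \<le> \<delta>1" "\<epsilon> * n \<le> \<delta>2" by auto
  qed
  define A where "A = K1 * (n\<^sup>2 + 1) + K2 * ((n\<^sup>2 + 1) * n + 1)"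
  have pos: "0 \<le> K1 * (n\<^sup>2 + 1)" "0 \<le> K2 * ((n\<^sup>2 + 1) * n + 1)"
    using K1 K2 n by auto
  have "norm (rescaled \<mu> d) \<le> CARD('c) * (A * \<mu>)" if \<mu>: "0 < \<mu>" "\<mu> < \<epsilon>" for \<mu>
  proof (rule norm_le_card_mult)
    fix p
    have small: "t * \<mu> \<le> \<epsilon> * n" if "t \<le> n" for t
      using \<mu> that mult_mono[of t n \<mu> \<epsilon>] n(1) by (simp add: mult.commute)
    have \<mu>n: "\<mu> \<le> \<epsilon> * n" using small[of 1] n by simp
    show "\<bar>rescaled \<mu> d $ p\<bar> \<le> A * \<mu>"
    proof (cases "maximal_cell sig p")
      case True
      have Dp: "\<bar>D p\<bar> = c" "(D p)\<^sup>2 = c\<^sup>2"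
        using D True c_pos by (auto simp: Dcoeffs_iff)
      have absD: "\<bar>\<mu> * D p\<bar> = c * \<mu>" using Dp \<mu> by (simp add: abs_mult)
      have "(\<mu> * D p)\<^sup>2 = c\<^sup>2 * \<mu>\<^sup>2" using Dp by (simp add: power_mult_distrib)
      then have "\<bar>f ((\<mu> * D p) *\<^sub>R 1, sg * \<mu>\<^sup>2)\<bar> \<le> K2 * ((c\<^sup>2 * \<mu>\<^sup>2 + \<mu>\<^sup>2) * (c * \<mu>) + \<mu> ^ 4)"
        using K2(3)[of "\<mu> * D p" \<mu>] absD small[OF n(3)] \<mu>n \<epsilon> \<mu> by simp
      also have "(c\<^sup>2 * \<mu>\<^sup>2 + \<mu>\<^sup>2) * (c * \<mu>) + \<mu> ^ 4 \<le> ((n\<^sup>2 + 1) * n + 1) * (\<mu> * \<mu>\<^sup>2)"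
      proof -
        have "(c\<^sup>2 + 1) * c \<le> (n\<^sup>2 + 1) * n"
          using n c_pos by (intro mult_mono add_mono power_mono) auto
        then have "((c\<^sup>2 + 1) * c + \<mu>) * (\<mu> * \<mu>\<^sup>2) \<le> ((n\<^sup>2 + 1) * n + 1) * (\<mu> * \<mu>\<^sup>2)"
          using \<mu> \<epsilon> by (intro mult_right_mono add_mono) auto
        then show ?thesis by (simp add: power2_eq_square power4_eq_xxxx algebra_simps)
      qed
      finally have "\<bar>f ((\<mu> * D p) *\<^sub>R 1, sg * \<mu>\<^sup>2)\<bar> \<le> K2 * (((n\<^sup>2 + 1) * n + 1) * (\<mu> * \<mu>\<^sup>2))"
        using K2(1) by simp
      also have "\<dots> = K2 * ((n\<^sup>2 + 1) * n + 1) * \<mu> * \<mu>\<^sup>2"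
        by (simp only: mult.assoc)
      also have "\<dots> \<le> A * \<mu> * \<mu>\<^sup>2"
        unfolding A_def using pos \<mu> by (intro mult_right_mono) auto
      finally show ?thesis
        using True \<mu> by (simp add: rescaled_def gamma_maximal d_def divide_le_eq)
    next
      case False
      have "(\<Sum>s\<in>UNIV. coef_a f s * (\<mu> *\<^sub>R d) $ sig s p) = \<mu> * (\<Sum>s\<in>UNIV. coef_a f s * D (sig s p))"
        by (simp add: d_def sum_distrib_left mult_ac)
      also have "\<dots> = 0" using D False by (simp add: Dcoeffs_iff)
      finally have "\<bar>gamma sig f (\<mu> *\<^sub>R d) (sg * \<mu>\<^sup>2) $ p\<bar> \<le> K1 * ((\<mu> * norm d)\<^sup>2 + \<mu>\<^sup>2)"
        using K1(3)[of "\<mu> *\<^sub>R d" \<mu> p] small[OF n(2)] \<mu>n \<epsilon> \<mu> by (simp add: mult.commute)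
      also have "(\<mu> * norm d)\<^sup>2 + \<mu>\<^sup>2 \<le> (n\<^sup>2 + 1) * \<mu>\<^sup>2"
      proof -
        have "((norm d)\<^sup>2 + 1) * \<mu>\<^sup>2 \<le> (n\<^sup>2 + 1) * \<mu>\<^sup>2"
          using n by (intro mult_right_mono add_mono power_mono) auto
        then show ?thesis by (simp add: power_mult_distrib algebra_simps)
      qed
      finally have "\<bar>gamma sig f (\<mu> *\<^sub>R d) (sg * \<mu>\<^sup>2) $ p\<bar> \<le> K1 * ((n\<^sup>2 + 1) * \<mu>\<^sup>2)"
        using K1(1) by simp
      also have "\<dots> = K1 * (n\<^sup>2 + 1) * \<mu> * \<mu>" by (simp add: power2_eq_square)
      also have "\<dots> \<le> A * \<mu> * \<mu>"
        unfolding A_def using pos \<mu> by (intro mult_right_mono) auto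
      finally show ?thesis
        using False \<mu> by (simp add: rescaled_def divide_le_eq)
    qed
  qed
  moreover have "CARD('c) * A \<ge> 0" using pos by (simp add: A_def)
  ultimately show ?thesis
    using \<epsilon>(1) unfolding d_def by (intro exI[of _ "CARD('c) * A"] conjI exI[of _ \<epsilon>]) (auto simp: mult.assoc)
qed

text \<open>Two errors are made small by different means. The Taylor remainders have Lipschitz
  constant of order \<mu> after rescaling and are controlled by \<epsilon>; the curvature of the
  quadratic term at maximal cells does not shrink with \<mu> and is controlled by \<rho>.\<close>

lemma rescaled_almost_linear:
  fixes D :: "'c \<Rightarrow> real"
  assumes \<eta>: "\<eta> > 0"
  defines "d \<equiv> (\<chi> p. D p)"
  shows "\<exists>\<rho>>0. \<exists>\<epsilon>>0. \<forall>\<mu> w w'. 0 < \<mu> \<longrightarrow> \<mu> < \<epsilon> \<longrightarrow> w \<in> cball d \<rho> \<longrightarrow> w' \<in> cball d \<rho> \<longrightarrow>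
    norm (rescaled \<mu> w - rescaled \<mu> w' - cell_map (\<lambda>p. 2 * Q * D p) (w - w')) \<le> \<eta> * norm (w - w')"
proof -
  obtain K1 \<delta>1 where K1: "K1 > 0" "\<delta>1 > 0"
    "\<And>p \<rho> x x' lam. \<rho> \<le> \<delta>1 \<Longrightarrow> norm x \<le> \<rho> \<Longrightarrow> norm x' \<le> \<rho> \<Longrightarrow> \<bar>lam\<bar> \<le> \<rho> \<Longrightarrow>
    \<bar>gamma sig f x lam $ p - gamma sig f x' lam $ p - (\<Sum>s\<in>UNIV. coef_a f s * (x - x') $ sig s p)\<bar>
      \<le> K1 * \<rho> * norm (x - x')"
    using input_difference_estimate by blast
  obtain K2 \<delta>2 where K2: "K2 > 0" "\<delta>2 > 0"
    "\<And>\<rho> lam y y'. \<rho> \<le> \<delta>2 \<Longrightarrow> \<bar>lam\<bar> \<le> \<delta>2 \<Longrightarrow> \<bar>y\<bar> \<le> \<rho> \<Longrightarrow> \<bar>y'\<bar> \<le> \<rho> \<Longrightarrow>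
    \<bar>f (y *\<^sub>R 1, lam) - f (y' *\<^sub>R 1, lam) - Q * (y\<^sup>2 - y'\<^sup>2)\<bar> \<le> K2 * (\<rho>\<^sup>2 + \<bar>lam\<bar>) * \<bar>y - y'\<bar>"
    using diagonal_quadratic_estimate[OF smooth sum_coef_a] unfolding Q_def by blast
  define n where "n = norm d + 1"
  have n: "n \<ge> 1" by (simp add: n_def)
  \<comment> \<open>The share of the tolerance available to each component, because passing from
    components to the norm costs the factor \<open>CARD('c)\<close>. At maximal cells it is split
    evenly between the two errors.\<close>
  define \<theta> where "\<theta> = \<eta> / CARD('c)"
  have \<theta>: "\<theta> > 0" "CARD('c) * \<theta> = \<eta>" using \<eta> by (auto simp: \<theta>_def)
  define A where "A = K1 * n + K2 * (n\<^sup>2 + 1)"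
  have pos: "0 < K1 * n" "0 < K2 * (n\<^sup>2 + 1)"
    using K1 K2 n by (auto intro!: mult_pos_pos add_nonneg_pos)
  then have A: "A > 0" by (simp add: A_def)
  define \<epsilon> where "\<epsilon> = Min {1, \<delta>1 / n, \<delta>2 / n, \<theta> / (2 * A)}"
  define \<rho> where "\<rho> = min 1 (\<theta> / (4 * \<bar>Q\<bar>))"
  have \<epsilon>: "\<epsilon> > 0" "\<epsilon> \<le> 1" "n * \<epsilon> \<le> \<delta>1" "n * \<epsilon> \<le> \<delta>2" "A * \<epsilon> \<le> \<theta> / 2"
  proof -
    show "\<epsilon> > 0" "\<epsilon> \<le> 1" using K1 K2 n A \<theta> by (auto simp: \<epsilon>_def)
    have "\<epsilon> \<le> \<delta>1 / n" "\<epsilon> \<le> \<delta>2 / n" "\<epsilon> \<le> \<theta> / (2 * A)" by (auto simp: \<epsilon>_def)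
    then show "n * \<epsilon> \<le> \<delta>1" "n * \<epsilon> \<le> \<delta>2" "A * \<epsilon> \<le> \<theta> / 2" using n A by (auto simp: field_simps)
  qed
  have \<rho>: "\<rho> > 0" "\<rho> \<le> 1" "\<bar>Q\<bar> * (2 * \<rho>) \<le> \<theta> / 2"
  proof -
    show "\<rho> > 0" "\<rho> \<le> 1" using \<theta> Q_nonzero by (auto simp: \<rho>_def)
    have "\<rho> \<le> \<theta> / (4 * \<bar>Q\<bar>)" by (simp add: \<rho>_def)
    then show "\<bar>Q\<bar> * (2 * \<rho>) \<le> \<theta> / 2" using Q_nonzero by (simp add: field_simps)
  qed
  have "norm (rescaled \<mu> w - rescaled \<mu> w' - cell_map (\<lambda>p. 2 * Q * D p) (w - w')) \<le> CARD('c) * (\<theta> * norm (w - w'))"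
    if \<mu>: "0 < \<mu>" "\<mu> < \<epsilon>" and w: "w \<in> cball d \<rho>" "w' \<in> cball d \<rho>" for \<mu> w w'
  proof (rule norm_le_card_mult)
    fix p
    define lam where "lam = sg * \<mu>\<^sup>2"
    have lam: "\<bar>lam\<bar> = \<mu>\<^sup>2" using sg by (simp add: lam_def abs_mult)
    have \<mu>\<epsilon>: "n * \<mu> \<le> n * \<epsilon>" using \<mu> n by simp
    have "\<mu>\<^sup>2 \<le> \<mu>" using \<mu> \<epsilon> by (auto simp: power2_eq_square intro: mult_left_le)
    also have "\<mu> \<le> n * \<mu>" using \<mu> n mult_right_mono[of 1 n \<mu>] by simp
    finally have lam_n: "\<bar>lam\<bar> \<le> n * \<mu>" using lam by simp
    have norm_w: "norm (\<mu> *\<^sub>R u) \<le> n * \<mu>" if "u \<in> cball d \<rho>" for u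
    proof -
      have "norm u \<le> norm d + norm (u - d)" by (metis norm_triangle_sub)
      then have "norm u \<le> n"
        using that \<rho> by (simp add: n_def dist_norm norm_minus_commute)
      then show ?thesis using \<mu> by simp
    qed
    have comp: "\<bar>u $ p\<bar> \<le> norm u" for u :: "real^'c" by (rule component_le_norm_cart)
    show "\<bar>(rescaled \<mu> w - rescaled \<mu> w' - cell_map (\<lambda>p. 2 * Q * D p) (w - w')) $ p\<bar> \<le> \<theta> * norm (w - w')"
    proof (cases "maximal_cell sig p")
      case True
      define y where "y = w $ p"
      define y' where "y' = w' $ p"
      define \<Delta> where "\<Delta> = f ((\<mu> * y) *\<^sub>R 1, lam) - f ((\<mu> * y') *\<^sub>R 1, lam) - Q * ((\<mu> * y)\<^sup>2 - (\<mu> * y')\<^sup>2)"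
      have yw: "\<bar>y - y'\<bar> \<le> norm (w - w')"
        using comp[of "w - w'"] by (simp add: y_def y'_def)
      have "\<bar>\<mu> * y\<bar> \<le> n * \<mu>" "\<bar>\<mu> * y'\<bar> \<le> n * \<mu>"
        using comp[of "\<mu> *\<^sub>R w"] comp[of "\<mu> *\<^sub>R w'"] norm_w[OF w(1)] norm_w[OF w(2)]
        by (auto simp: y_def y'_def)
      then have "\<bar>\<Delta>\<bar> \<le> K2 * ((n * \<mu>)\<^sup>2 + \<bar>lam\<bar>) * \<bar>\<mu> * y - \<mu> * y'\<bar>"
        unfolding \<Delta>_def using \<mu>\<epsilon> \<epsilon> lam_n by (intro K2(3)) auto
      also have "\<dots> = K2 * (n\<^sup>2 + 1) * \<mu> * \<bar>y - y'\<bar> * \<mu>\<^sup>2"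
      proof -
        have "\<bar>\<mu> * y - \<mu> * y'\<bar> = \<mu> * \<bar>y - y'\<bar>"
          using \<mu> by (simp add: abs_mult flip: right_diff_distrib)
        then show ?thesis
          unfolding lam by (simp add: power2_eq_square distrib_left distrib_right mult_ac)
      qed
      finally have 1: "\<bar>\<Delta> / \<mu>\<^sup>2\<bar> \<le> K2 * (n\<^sup>2 + 1) * \<mu> * \<bar>y - y'\<bar>"
        using \<mu> by (simp add: divide_le_eq)
      have "K2 * (n\<^sup>2 + 1) * \<mu> \<le> A * \<epsilon>"
        using pos A \<mu> by (intro mult_mono) (auto simp: A_def)
      then have 2: "K2 * (n\<^sup>2 + 1) * \<mu> * \<bar>y - y'\<bar> \<le> \<theta> / 2 * \<bar>y - y'\<bar>"
        using \<epsilon> by (intro mult_right_mono) auto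
      have "\<bar>y - D p\<bar> \<le> \<rho>" "\<bar>y' - D p\<bar> \<le> \<rho>"
        using comp[of "w - d"] comp[of "w' - d"] w
        by (auto simp: y_def y'_def d_def dist_norm norm_minus_commute)
      then have "\<bar>y + y' - 2 * D p\<bar> \<le> 2 * \<rho>" by linarith
      then have "\<bar>Q\<bar> * \<bar>y + y' - 2 * D p\<bar> \<le> \<bar>Q\<bar> * (2 * \<rho>)" by (intro mult_left_mono) auto
      then have 3: "\<bar>Q * (y + y' - 2 * D p) * (y - y')\<bar> \<le> \<theta> / 2 * \<bar>y - y'\<bar>"
        unfolding abs_mult using \<rho>(3) by (intro mult_right_mono) auto
      \<comment> \<open>The curvature error comes from \<open>Q * (y\<^sup>2 - y'\<^sup>2) - 2 * Q *
        D p * (y - y') = Q * (y + y' - 2 * D p) * (y - y')\<close>.\<close>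
      have "(rescaled \<mu> w - rescaled \<mu> w' - cell_map (\<lambda>p. 2 * Q * D p) (w - w')) $ p
          = \<Delta> / \<mu>\<^sup>2 + Q * (y + y' - 2 * D p) * (y - y')"
        using True \<mu> by (simp add: rescaled_def gamma_maximal cell_map_def \<Delta>_def lam_def y_def y'_def
            field_simps power2_eq_square)
      then have "\<bar>(rescaled \<mu> w - rescaled \<mu> w' - cell_map (\<lambda>p. 2 * Q * D p) (w - w')) $ p\<bar> \<le> \<theta> * \<bar>y - y'\<bar>"
        using 1 2 3 by linarith
      also have "\<dots> \<le> \<theta> * norm (w - w')" using yw \<theta> by simp
      finally show ?thesis .
    next
      case False
      define \<Delta> where "\<Delta> = gamma sig f (\<mu> *\<^sub>R w) lam $ p - gamma sig f (\<mu> *\<^sub>R w') lam $ p -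
        (\<Sum>s\<in>UNIV. coef_a f s * (\<mu> *\<^sub>R w - \<mu> *\<^sub>R w') $ sig s p)"
      have "\<bar>\<Delta>\<bar> \<le> K1 * (n * \<mu>) * norm (\<mu> *\<^sub>R w - \<mu> *\<^sub>R w')"
        unfolding \<Delta>_def using \<mu>\<epsilon> \<epsilon> lam_n norm_w w by (intro K1(3)) auto
      also have "\<dots> = K1 * n * \<mu> * norm (w - w') * \<mu>"
        using \<mu> by (simp flip: scaleR_diff_right)
      finally have 1: "\<bar>\<Delta> / \<mu>\<bar> \<le> K1 * n * \<mu> * norm (w - w')"
        using \<mu> by (simp add: divide_le_eq)
      have "K1 * n * \<mu> \<le> A * \<epsilon>"
        using pos A \<mu> by (intro mult_mono) (auto simp: A_def)
      then have 2: "K1 * n * \<mu> * norm (w - w') \<le> \<theta> * norm (w - w')"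
        using \<epsilon> \<theta> by (intro mult_right_mono) auto
      have "(\<Sum>s\<in>UNIV. coef_a f s * (\<mu> *\<^sub>R w - \<mu> *\<^sub>R w') $ sig s p) =
          \<mu> * (\<Sum>s\<in>UNIV. coef_a f s * (w - w') $ sig s p)"
        by (simp add: sum_distrib_left algebra_simps)
      then have "\<Delta> / \<mu> = gamma sig f (\<mu> *\<^sub>R w) lam $ p / \<mu> - gamma sig f (\<mu> *\<^sub>R w') lam $ p / \<mu> -
          (\<Sum>s\<in>UNIV. coef_a f s * (w - w') $ sig s p)"
        using \<mu> by (simp add: \<Delta>_def diff_divide_distrib)
      then have "(rescaled \<mu> w - rescaled \<mu> w' - cell_map (\<lambda>p. 2 * Q * D p) (w - w')) $ p = \<Delta> / \<mu>"
        using False by (simp add: rescaled_def cell_map_def lam_def)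
      then show ?thesis using 1 2 by linarith
    qed
  qed
  then have "norm (rescaled \<mu> w - rescaled \<mu> w' - cell_map (\<lambda>p. 2 * Q * D p) (w - w')) \<le> \<eta> * norm (w - w')"
    if "0 < \<mu>" "\<mu> < \<epsilon>" "w \<in> cball d \<rho>" "w' \<in> cball d \<rho>" for \<mu> w w'
    using that \<theta>(2) by (simp add: mult.assoc[symmetric])
  then show ?thesis
    using \<rho>(1) \<epsilon>(1) by blast
qed

lemma branch_through_Dcoeffs:
  assumes D: "D \<in> Dcoeffs sig f c"
  shows "\<exists>\<rho>>0. \<exists>\<epsilon>>0. \<exists>K\<ge>0. \<exists>W. continuous_on {0<..<\<epsilon>} W \<and>
    (\<forall>\<mu>\<in>{0<..<\<epsilon>}. rescaled \<mu> (W \<mu>) = 0 \<and> norm (W \<mu> - (\<chi> p. D p)) \<le> K * \<mu> \<and>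
       (\<forall>w\<in>cball (\<chi> p. D p) \<rho>. rescaled \<mu> w = 0 \<longrightarrow> w = W \<mu>))"
proof (rule perturbed_zero_branch)
  show "linear (cell_map (\<lambda>p. 2 * Q * D p))" by (rule linear_cell_map)
  \<comment> \<open>The values \<open>c\<close> and \<open>- c\<close> are simple roots of the limit
    equation at a maximal cell, so the diagonal entry \<open>2 * Q * D p\<close> is nonzero
    there.\<close>
  show "inj (cell_map (\<lambda>p. 2 * Q * D p))"
    using D Q_nonzero c_pos by (intro inj_cell_map) (auto simp: Dcoeffs_iff)
qed (use rescaled_almost_linear rescaled_at_Dcoeffs[OF D] continuous_on_rescaled in auto)

lemma rescaled_branches:
  obtains \<epsilon> r W where "\<epsilon> > 0" "r > 0"
    and "\<And>D. D \<in> Dcoeffs sig f c \<Longrightarrow> continuous_on {0<..<\<epsilon>} (W D)"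
    and "\<And>D \<mu>. D \<in> Dcoeffs sig f c \<Longrightarrow> \<mu> \<in> {0<..<\<epsilon>} \<Longrightarrow> gamma sig f (\<mu> *\<^sub>R W D \<mu>) (sg * \<mu>\<^sup>2) = 0"
    and "\<And>D. D \<in> Dcoeffs sig f c \<Longrightarrow> \<exists>K. \<forall>\<mu>\<in>{0<..<\<epsilon>}. norm (W D \<mu> - (\<chi> p. D p)) \<le> K * \<mu>"
    and "\<And>D D' \<mu>. D \<in> Dcoeffs sig f c \<Longrightarrow> D' \<in> Dcoeffs sig f c \<Longrightarrow> D \<noteq> D' \<Longrightarrow> \<mu> \<in> {0<..<\<epsilon>} \<Longrightarrow>
      W D \<mu> \<noteq> W D' \<mu>"
    and "\<And>x \<mu>. \<mu> \<in> {0<..<\<epsilon>} \<Longrightarrow> norm x < r \<Longrightarrow> gamma sig f x (sg * \<mu>\<^sup>2) = 0 \<Longrightarrow>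
      \<exists>D\<in>Dcoeffs sig f c. x = \<mu> *\<^sub>R W D \<mu>"
proof -
  let ?D = "Dcoeffs sig f c"
  have fin: "finite ?D"
    \<comment> \<open>An infinite set would have \<open>card\<close> 0, while a power of 2 is
      nonzero.\<close>
    using card_Dcoeffs by (metis card.infinite power_not_zero zero_neq_numeral)
  have "\<forall>D. \<exists>\<rho> e K W. D \<in> ?D \<longrightarrow> \<rho> > 0 \<and> e > 0 \<and> K \<ge> 0 \<and> continuous_on {0<..<e} W \<and>
    (\<forall>\<mu>\<in>{0<..<e}. rescaled \<mu> (W \<mu>) = 0 \<and> norm (W \<mu> - (\<chi> p. D p)) \<le> K * \<mu> \<and>
       (\<forall>w\<in>cball (\<chi> p. D p) \<rho>. rescaled \<mu> w = 0 \<longrightarrow> w = W \<mu>))"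
    using branch_through_Dcoeffs by meson
  then obtain \<rho> e K W where W: "\<And>D. D \<in> ?D \<Longrightarrow> \<rho> D > 0 \<and> e D > 0 \<and> K D \<ge> 0 \<and> continuous_on {0<..<e D} (W D) \<and>
    (\<forall>\<mu>\<in>{0<..<e D}. rescaled \<mu> (W D \<mu>) = 0 \<and> norm (W D \<mu> - (\<chi> p. D p)) \<le> K D * \<mu> \<and>
       (\<forall>w\<in>cball (\<chi> p. D p) (\<rho> D). rescaled \<mu> w = 0 \<longrightarrow> w = W D \<mu>))"
    unfolding choice_iff by blast
  obtain r \<epsilon>0 K0 where K0: "r > 0" "\<epsilon>0 > 0" "K0 > 0"
    "\<And>x \<mu>. 0 < \<mu> \<Longrightarrow> \<mu> < \<epsilon>0 \<Longrightarrow> norm x < r \<Longrightarrow> gamma sig f x (sg * \<mu>\<^sup>2) = 0 \<Longrightarrow>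
      \<exists>D\<in>?D. norm (x - \<mu> *\<^sub>R (\<chi> p. D p)) \<le> K0 * \<mu>\<^sup>2"
    using small_steady_state_near_Dcoeffs by blast
  \<comment> \<open>The three bounds keep \<mu> in the domain of the branch, place every point
    allowed by the a priori estimate inside the uniqueness ball of radius \<open>\<rho> D\<close>,
    and keep the branch closer than \<open>c\<close> to its centre \<open>D\<close>. As there are
    finitely many \<open>D\<close>, the minimum over them is positive.\<close>
  define bound where "bound D = min (e D) (min (\<rho> D / K0) (c / (K D + 1)))" for D
  define \<epsilon> where "\<epsilon> = Min (insert \<epsilon>0 (bound ` ?D))"
  have "bound D > 0" if "D \<in> ?D" for D
    using W[OF that] K0(3) c_pos by (simp add: bound_def)
  then have \<epsilon>: "\<epsilon> > 0" "\<epsilon> \<le> \<epsilon>0"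
    using fin K0 by (auto simp: \<epsilon>_def)
  have le: "\<epsilon> \<le> e D" "K0 * \<epsilon> \<le> \<rho> D" "(K D + 1) * \<epsilon> \<le> c" if "D \<in> ?D" for D
  proof -
    have "\<epsilon> \<le> bound D" using fin that by (simp add: \<epsilon>_def)
    then show "\<epsilon> \<le> e D" "K0 * \<epsilon> \<le> \<rho> D" "(K D + 1) * \<epsilon> \<le> c"
      using K0(3) W[OF that] by (auto simp: bound_def field_simps)
  qed
  have near: "norm (W D \<mu> - (\<chi> p. D p)) < c" if "D \<in> ?D" "\<mu> \<in> {0<..<\<epsilon>}" for D \<mu>
  proof -
    have "norm (W D \<mu> - (\<chi> p. D p)) \<le> K D * \<mu>"
      using W[OF that(1)] le(1)[OF that(1)] that(2) by auto
    also have "\<dots> < (K D + 1) * \<mu>" using that(2) by (simp add: distrib_right)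
    also have "\<dots> \<le> (K D + 1) * \<epsilon>" using that(2) W[OF that(1)] by (intro mult_left_mono) auto
    finally show ?thesis using le(3)[OF that(1)] by simp
  qed
  have distinct: "W D \<mu> \<noteq> W D' \<mu>" if D: "D \<in> ?D" "D' \<in> ?D" "D \<noteq> D'" and \<mu>: "\<mu> \<in> {0<..<\<epsilon>}" for D D' \<mu>
  proof
    assume eq: "W D \<mu> = W D' \<mu>"
    \<comment> \<open>Different coefficient vectors differ by \<open>2 * c\<close> at some maximal
      cell, while each branch stays within less than \<open>c\<close> of its own vector, so the two
      cannot meet.\<close>
    obtain p where p: "maximal_cell sig p" "D p \<noteq> D' p"
      using Dcoeffs_eqI[of D D'] D by blast
    moreover have "D p = c \<or> D p = - c" "D' p = c \<or> D' p = - c"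
      using D p(1) by (auto simp: Dcoeffs_iff)
    ultimately have "\<bar>D p - D' p\<bar> = 2 * c"
      using c_pos by auto
    moreover have "\<bar>W D \<mu> $ p - D p\<bar> < c" "\<bar>W D' \<mu> $ p - D' p\<bar> < c"
      using near[OF D(1) \<mu>] near[OF D(2) \<mu>] component_le_norm_cart[of "W D \<mu> - (\<chi> p. D p)" p]
        component_le_norm_cart[of "W D' \<mu> - (\<chi> p. D' p)" p] by auto
    ultimately show False unfolding eq by linarith
  qed
  have all: "\<exists>D\<in>?D. x = \<mu> *\<^sub>R W D \<mu>"
    if "\<mu> \<in> {0<..<\<epsilon>}" "norm x < r" "gamma sig f x (sg * \<mu>\<^sup>2) = 0" for x \<mu>
  proof -
    have *: "0 < \<mu>" "\<mu> < \<epsilon>" "norm x < r" "gamma sig f x (sg * \<mu>\<^sup>2) = 0"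
      using that by auto
    obtain D where D: "D \<in> ?D" "norm (x - \<mu> *\<^sub>R (\<chi> p. D p)) \<le> K0 * \<mu>\<^sup>2"
      using K0(4)[of \<mu> x] * \<epsilon> by auto
    define w where "w = inverse \<mu> *\<^sub>R x"
    have x: "x = \<mu> *\<^sub>R w" using * by (simp add: w_def)
    have "\<mu> * norm (w - (\<chi> p. D p)) = norm (x - \<mu> *\<^sub>R (\<chi> p. D p))"
      using * by (simp add: x flip: scaleR_diff_right)
    also have "\<dots> \<le> \<mu> * (K0 * \<mu>)" using D by (simp add: power2_eq_square mult_ac)
    finally have "norm (w - (\<chi> p. D p)) \<le> K0 * \<mu>" using * by simp
    also have "\<dots> \<le> K0 * \<epsilon>" using * K0 by simp
    finally have "w \<in> cball (\<chi> p. D p) (\<rho> D)"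
      using le(2)[OF D(1)] by (simp add: dist_norm norm_minus_commute)
    moreover have "rescaled \<mu> w = 0"
      using * x by (simp add: rescaled_eq_0_iff)
    moreover have "\<mu> \<in> {0<..<e D}" using * le(1)[OF D(1)] by simp
    ultimately have "w = W D \<mu>" using W[OF D(1)] by blast
    then show ?thesis using D(1) x by blast
  qed
  have sub: "{0<..<\<epsilon>} \<subseteq> {0<..<e D}" if "D \<in> ?D" for D
    using le(1)[OF that] by auto
  show thesis
  proof (rule that[of \<epsilon> r W])
    show "continuous_on {0<..<\<epsilon>} (W D)" if D: "D \<in> ?D" for D
      using W[OF D] continuous_on_subset[OF _ sub[OF D]] by blast
    show "gamma sig f (\<mu> *\<^sub>R W D \<mu>) (sg * \<mu>\<^sup>2) = 0" if D: "D \<in> ?D" and \<mu>: "\<mu> \<in> {0<..<\<epsilon>}" for D \<mu>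
    proof -
      have "rescaled \<mu> (W D \<mu>) = 0"
        using W[OF D] sub[OF D] \<mu> by blast
      then show ?thesis
        using \<mu> by (simp add: rescaled_eq_0_iff)
    qed
    show "\<exists>K. \<forall>\<mu>\<in>{0<..<\<epsilon>}. norm (W D \<mu> - (\<chi> p. D p)) \<le> K * \<mu>" if D: "D \<in> ?D" for D
      using W[OF D] sub[OF D] by blast
  qed (fact \<epsilon>(1) K0(1) distinct all)+
qed

section \<open>Return from the scale \<mu> to the bifurcation parameter\<close>

definition side_interval :: "real \<Rightarrow> real set" where
  "side_interval \<epsilon> = {lam. 0 < sg * lam \<and> sg * lam < \<epsilon>}"

lemma sg_mult_sg: "sg * (sg * t) = t"
proof -
  have "sg * sg = 1"
    using sg by (metis abs_mult_self_eq mult_1)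
  then show ?thesis by (simp flip: mult.assoc)
qed

text \<open>The substitution is undone by \<open>\<mu> = sqrt (sg * lam)\<close>. The error of order
  \<mu> in \<open>W D\<close> is multiplied by \<mu>, which gives order
  \<open>\<bar>lam\<bar>\<close>; the range \<open>\<mu> < \<epsilon>\<close> becomes
  \<open>\<bar>lam\<bar> < \<epsilon>\<^sup>2\<close>.\<close>

lemma steady_state_branches:
  "\<exists>\<epsilon>>0. \<exists>X :: ('c \<Rightarrow> real) \<Rightarrow> real \<Rightarrow> real^'c.
    (\<forall>D\<in>Dcoeffs sig f c. continuous_on (side_interval \<epsilon>) (X D) \<and>
       (\<forall>lam\<in>side_interval \<epsilon>. gamma sig f (X D lam) lam = 0) \<and>
       (\<exists>K. \<forall>lam\<in>side_interval \<epsilon>. \<forall>p. \<bar>X D lam $ p - D p * sqrt (sg * lam)\<bar> \<le> K * \<bar>lam\<bar>)) \<and>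
    (\<forall>D\<in>Dcoeffs sig f c. \<forall>D'\<in>Dcoeffs sig f c. D \<noteq> D' \<longrightarrow> (\<forall>lam\<in>side_interval \<epsilon>. X D lam \<noteq> X D' lam)) \<and>
    (\<exists>r>0. \<forall>x lam. lam \<in> side_interval \<epsilon> \<and> norm x < r \<and> gamma sig f x lam = 0
         \<longrightarrow> (\<exists>D\<in>Dcoeffs sig f c. x = X D lam))"
proof -
  let ?D = "Dcoeffs sig f c"
  obtain \<epsilon> r W where \<epsilon>: "\<epsilon> > 0" and r: "r > 0"
    and cont: "\<And>D. D \<in> ?D \<Longrightarrow> continuous_on {0<..<\<epsilon>} (W D)"
    and zero: "\<And>D \<mu>. D \<in> ?D \<Longrightarrow> \<mu> \<in> {0<..<\<epsilon>} \<Longrightarrow> gamma sig f (\<mu> *\<^sub>R W D \<mu>) (sg * \<mu>\<^sup>2) = 0"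
    and asymp: "\<And>D. D \<in> ?D \<Longrightarrow> \<exists>K. \<forall>\<mu>\<in>{0<..<\<epsilon>}. norm (W D \<mu> - (\<chi> p. D p)) \<le> K * \<mu>"
    and distinct: "\<And>D D' \<mu>. D \<in> ?D \<Longrightarrow> D' \<in> ?D \<Longrightarrow> D \<noteq> D' \<Longrightarrow> \<mu> \<in> {0<..<\<epsilon>} \<Longrightarrow> W D \<mu> \<noteq> W D' \<mu>"
    and all: "\<And>x \<mu>. \<mu> \<in> {0<..<\<epsilon>} \<Longrightarrow> norm x < r \<Longrightarrow> gamma sig f x (sg * \<mu>\<^sup>2) = 0 \<Longrightarrow>
      \<exists>D\<in>?D. x = \<mu> *\<^sub>R W D \<mu>"
    using rescaled_branches by blast
  define X where "X D lam = sqrt (sg * lam) *\<^sub>R W D (sqrt (sg * lam))" for D lam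
  have \<mu>: "sqrt (sg * lam) \<in> {0<..<\<epsilon>}" "sg * (sqrt (sg * lam))\<^sup>2 = lam" if "lam \<in> side_interval (\<epsilon>\<^sup>2)" for lam
    using that \<epsilon> sg_mult_sg real_less_lsqrt[of \<epsilon> "sg * lam"] by (auto simp: side_interval_def)
  have cont': "continuous_on (side_interval (\<epsilon>\<^sup>2)) (X D)" if "D \<in> ?D" for D
    unfolding X_def by (intro continuous_intros continuous_on_compose2[OF cont[OF that]]) (use \<mu>(1) in auto)
  have zero': "gamma sig f (X D lam) lam = 0" if "D \<in> ?D" "lam \<in> side_interval (\<epsilon>\<^sup>2)" for D lam
    using zero[OF that(1) \<mu>(1)[OF that(2)]] \<mu>(2)[OF that(2)] by (simp add: X_def)
  have asymp': "\<exists>K. \<forall>lam\<in>side_interval (\<epsilon>\<^sup>2). \<forall>p. \<bar>X D lam $ p - D p * sqrt (sg * lam)\<bar> \<le> K * \<bar>lam\<bar>"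
    if "D \<in> ?D" for D
  proof -
    obtain K where K: "\<And>\<mu>. \<mu> \<in> {0<..<\<epsilon>} \<Longrightarrow> norm (W D \<mu> - (\<chi> p. D p)) \<le> K * \<mu>"
      using asymp[OF \<open>D \<in> ?D\<close>] by blast
    have "\<bar>X D lam $ p - D p * sqrt (sg * lam)\<bar> \<le> K * \<bar>lam\<bar>" if lam: "lam \<in> side_interval (\<epsilon>\<^sup>2)" for lam p
    proof -
      define \<nu> where "\<nu> = sqrt (sg * lam)"
      have \<nu>: "\<nu> \<in> {0<..<\<epsilon>}" "sg * \<nu>\<^sup>2 = lam" using \<mu>[OF lam] by (auto simp: \<nu>_def)
      have "\<bar>W D \<nu> $ p - D p\<bar> \<le> K * \<nu>"
        using K[OF \<nu>(1)] component_le_norm_cart[of "W D \<nu> - (\<chi> p. D p)" p] by simp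
      moreover have "X D lam $ p - D p * \<nu> = \<nu> * (W D \<nu> $ p - D p)"
        by (simp add: X_def \<nu>_def algebra_simps)
      then have "\<bar>X D lam $ p - D p * \<nu>\<bar> = \<nu> * \<bar>W D \<nu> $ p - D p\<bar>"
        using \<nu> by (simp add: abs_mult)
      ultimately have "\<bar>X D lam $ p - D p * \<nu>\<bar> \<le> \<nu> * (K * \<nu>)"
        using \<nu> by simp
      also have "\<dots> = K * \<bar>lam\<bar>"
        using \<nu>(2)[symmetric] sg by (simp add: abs_mult power2_eq_square)
      finally show ?thesis unfolding \<nu>_def .
    qed
    then show ?thesis by blast
  qed
  have distinct': "X D lam \<noteq> X D' lam"
    if "D \<in> ?D" "D' \<in> ?D" "D \<noteq> D'" "lam \<in> side_interval (\<epsilon>\<^sup>2)" for D D' lam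
    using distinct[OF that(1-3) \<mu>(1)[OF that(4)]] \<mu>(1)[OF that(4)] by (auto simp: X_def)
  have all': "\<exists>D\<in>?D. x = X D lam"
    if "lam \<in> side_interval (\<epsilon>\<^sup>2)" "norm x < r" "gamma sig f x lam = 0" for x lam
    using all[OF \<mu>(1)[OF that(1)] that(2)] \<mu>(2)[OF that(1)] that(3) by (simp add: X_def)
  have "\<exists>r>0. \<forall>x lam. lam \<in> side_interval (\<epsilon>\<^sup>2) \<and> norm x < r \<and> gamma sig f x lam = 0
      \<longrightarrow> (\<exists>D\<in>?D. x = X D lam)"
    using r all' by blast
  then show ?thesis
    using \<epsilon> cont' zero' asymp' distinct'
    by (intro exI[of _ "\<epsilon>\<^sup>2"] conjI[of "0 < \<epsilon>\<^sup>2"] exI[of _ X]) simp_all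
qed

end

theorem theorem4p6:
  fixes sig :: "'s::finite \<Rightarrow> 'c::finite \<Rightarrow> 'c"
    and f :: "(real^'s) \<times> real \<Rightarrow> real"
  defines "S \<equiv> (\<Sum>s\<in>UNIV. \<Sum>t\<in>UNIV. coef_f2 f s t)"
    and "l \<equiv> coef_l f"
    and "m \<equiv> card {p. maximal_cell sig p}"
  assumes net: "network sig"
    and ff: "feedforward sig"
    and smooth: "smooth_fun f"
    and f00: "f (0, 0) = 0"
    and crit_max: "\<forall>p. maximal_cell sig p \<longrightarrow> critical sig f p"
    and noncrit: "\<forall>p. \<not> maximal_cell sig p \<longrightarrow> \<not> critical sig f p"
  shows
   "(l / S < 0 \<longrightarrow> (\<forall>D\<in>Dcoeffs sig f (sqrt (- l / S)). \<forall>p. D p \<noteq> 0) \<longrightarrow>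
      (let \<D> = Dcoeffs sig f (sqrt (- l / S)) in
        card \<D> = 2 ^ m \<and>
        (\<exists>\<epsilon>>0. \<exists>X :: ('c \<Rightarrow> real) \<Rightarrow> real \<Rightarrow> real^'c.
          (\<forall>D\<in>\<D>. continuous_on {0<..<\<epsilon>} (X D) \<and>
             (\<forall>lam\<in>{0<..<\<epsilon>}. gamma sig f (X D lam) lam = 0) \<and>
             (\<exists>K. \<forall>lam\<in>{0<..<\<epsilon>}. \<forall>p. \<bar>X D lam $ p - D p * sqrt lam\<bar> \<le> K * \<bar>lam\<bar>)) \<and>
          (\<forall>D\<in>\<D>. \<forall>D'\<in>\<D>. D \<noteq> D' \<longrightarrow> (\<forall>lam\<in>{0<..<\<epsilon>}. X D lam \<noteq> X D' lam)) \<and>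
          (\<exists>r>0. \<forall>x lam. 0 < lam \<and> lam < \<epsilon> \<and> norm x < r \<and> gamma sig f x lam = 0
               \<longrightarrow> (\<exists>D\<in>\<D>. x = X D lam)))))
    \<and>
    (l / S > 0 \<longrightarrow> (\<forall>D\<in>Dcoeffs sig f (sqrt (l / S)). \<forall>p. D p \<noteq> 0) \<longrightarrow>
      (let \<D> = Dcoeffs sig f (sqrt (l / S)) in
        card \<D> = 2 ^ m \<and>
        (\<exists>\<epsilon>>0. \<exists>X :: ('c \<Rightarrow> real) \<Rightarrow> real \<Rightarrow> real^'c.
          (\<forall>D\<in>\<D>. continuous_on {-\<epsilon><..<0} (X D) \<and>
             (\<forall>lam\<in>{-\<epsilon><..<0}. gamma sig f (X D lam) lam = 0) \<and>
             (\<exists>K. \<forall>lam\<in>{-\<epsilon><..<0}. \<forall>p. \<bar>X D lam $ p - D p * sqrt (- lam)\<bar> \<le> K * \<bar>lam\<bar>)) \<and>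
          (\<forall>D\<in>\<D>. \<forall>D'\<in>\<D>. D \<noteq> D' \<longrightarrow> (\<forall>lam\<in>{-\<epsilon><..<0}. X D lam \<noteq> X D' lam)) \<and>
          (\<exists>r>0. \<forall>x lam. -\<epsilon> < lam \<and> lam < 0 \<and> norm x < r \<and> gamma sig f x lam = 0
               \<longrightarrow> (\<exists>D\<in>\<D>. x = X D lam)))))"
proof (intro conjI impI)
  assume "l / S < 0"
  then interpret critical_feedforward sig f 1
    using ff smooth f00 crit_max noncrit by unfold_locales (auto simp: S_def l_def)
  have c: "sqrt (- l / S) = c"
    by (simp add: c_def l_def S_def Q_def)
  have side: "side_interval \<epsilon> = {0<..<\<epsilon>}" for \<epsilon>
    by (auto simp: side_interval_def)
  show "let \<D> = Dcoeffs sig f (sqrt (- l / S)) in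
        card \<D> = 2 ^ m \<and>
        (\<exists>\<epsilon>>0. \<exists>X :: ('c \<Rightarrow> real) \<Rightarrow> real \<Rightarrow> real^'c.
          (\<forall>D\<in>\<D>. continuous_on {0<..<\<epsilon>} (X D) \<and>
             (\<forall>lam\<in>{0<..<\<epsilon>}. gamma sig f (X D lam) lam = 0) \<and>
             (\<exists>K. \<forall>lam\<in>{0<..<\<epsilon>}. \<forall>p. \<bar>X D lam $ p - D p * sqrt lam\<bar> \<le> K * \<bar>lam\<bar>)) \<and>
          (\<forall>D\<in>\<D>. \<forall>D'\<in>\<D>. D \<noteq> D' \<longrightarrow> (\<forall>lam\<in>{0<..<\<epsilon>}. X D lam \<noteq> X D' lam)) \<and>
          (\<exists>r>0. \<forall>x lam. 0 < lam \<and> lam < \<epsilon> \<and> norm x < r \<and> gamma sig f x lam = 0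
               \<longrightarrow> (\<exists>D\<in>\<D>. x = X D lam)))"
    using card_Dcoeffs steady_state_branches
    unfolding Let_def c m_def side mult_1 greaterThanLessThan_iff conj_assoc by blast
next
  assume "l / S > 0"
  \<comment> \<open>With \<open>sg = -1\<close> the locale condition reads
    \<open>- l / S < 0\<close>, its constant \<open>c\<close> is \<open>sqrt (l / S)\<close>, and
    \<open>sqrt (sg * lam)\<close> becomes \<open>sqrt (- lam)\<close>.\<close>
  then interpret critical_feedforward sig f "-1"
    using ff smooth f00 crit_max noncrit by unfold_locales (auto simp: S_def l_def)
  have c: "sqrt (l / S) = c"
    by (simp add: c_def l_def S_def Q_def)
  have side: "side_interval \<epsilon> = {-\<epsilon><..<0}" for \<epsilon>
    by (auto simp: side_interval_def)
  show "let \<D> = Dcoeffs sig f (sqrt (l / S)) in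
        card \<D> = 2 ^ m \<and>
        (\<exists>\<epsilon>>0. \<exists>X :: ('c \<Rightarrow> real) \<Rightarrow> real \<Rightarrow> real^'c.
          (\<forall>D\<in>\<D>. continuous_on {-\<epsilon><..<0} (X D) \<and>
             (\<forall>lam\<in>{-\<epsilon><..<0}. gamma sig f (X D lam) lam = 0) \<and>
             (\<exists>K. \<forall>lam\<in>{-\<epsilon><..<0}. \<forall>p. \<bar>X D lam $ p - D p * sqrt (- lam)\<bar> \<le> K * \<bar>lam\<bar>)) \<and>
          (\<forall>D\<in>\<D>. \<forall>D'\<in>\<D>. D \<noteq> D' \<longrightarrow> (\<forall>lam\<in>{-\<epsilon><..<0}. X D lam \<noteq> X D' lam)) \<and>
          (\<exists>r>0. \<forall>x lam. -\<epsilon> < lam \<and> lam < 0 \<and> norm x < r \<and> gamma sig f x lam = 0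
               \<longrightarrow> (\<exists>D\<in>\<D>. x = X D lam)))"
    using card_Dcoeffs steady_state_branches
    unfolding Let_def c m_def side mult_minus_left mult_1 greaterThanLessThan_iff conj_assoc by blast
qed

end
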